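(* Let $t\ge 1$ and $r\ge 2$ be integers with $r\le 2t+2$, and let $k=\min\{r-1,t+1\}$. Then, as $n\to\infty$, $$\mathrm{ex}_r(n,\text{Berge-}B_t)=\frac{n^2}{4k(r-k)}+o(n^2).$$
   Context: For a graph $F$ and a hypergraph $\mathcal H$, $\mathcal H$ contains a Berge copy of $F$ (a Berge-$F$) if there is an injection $\varphi:V(F)\to V(\mathcal H)$ and an injection $f:E(F)\to E(\mathcal H)$ such that for every edge $xy\in E(F)$, $\{\varphi(x),\varphi(y)\}\subseteq f(xy)$. $\mathrm{ex}_r(n,\text{Berge-}F)$ denotes the maximum number of hyperedges in an $n$-vertex $r$-uniform hypergraph (hyperedges are distinct $r$-subsets) containing no Berge-$F$. The book graph $B_t$ has vertices $u,v,w_1,\dots,w_t$ and edges $uv$, $uw_i$, $vw_i$ for $1\le i\le t$. *)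

theory Defs
  imports Complex_Main "HOL-Library.Landau_Symbols"
begin

definition berge_copy :: "'v set \<Rightarrow> 'v set set \<Rightarrow> nat \<Rightarrow> nat set set \<Rightarrow> bool" where
  "berge_copy VF EF n H \<longleftrightarrow>
     (\<exists>\<phi> f. inj_on \<phi> VF \<and> \<phi> ` VF \<subseteq> {..<n} \<and> inj_on f EF \<and> f ` EF \<subseteq> H \<and>
            (\<forall>e\<in>EF. \<phi> ` e \<subseteq> f e))"

definition uniform_hypergraphs :: "nat \<Rightarrow> nat \<Rightarrow> nat set set set" where
  "uniform_hypergraphs r n = Pow {e. e \<subseteq> {..<n} \<and> card e = r}"

definition ex_berge :: "nat \<Rightarrow> nat \<Rightarrow> 'v set \<Rightarrow> 'v set set \<Rightarrow> nat" where
  "ex_berge r n VF EF =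
     Max (card ` {H \<in> uniform_hypergraphs r n. \<not> berge_copy VF EF n H})"

text \<open>Book graph B_t: u = 0, v = 1, w_i = i + 1 for 1 \<le> i \<le> t.\<close>

definition book_vertices :: "nat \<Rightarrow> nat set" where
  "book_vertices t = {0..t+1}"

definition book_edges :: "nat \<Rightarrow> nat set set" where
  "book_edges t = insert {0, 1} ((\<Union>i\<in>{1..t}. {{0, i+1}, {1, i+1}}))"

end

theory Submission
  imports Defs
begin

text \<open>Lower bound: split a vertex half into blocks of size \<open>k\<close> and the other half into blocks of size
  \<open>r - k\<close>, and take all unions of a left and a right block. Two vertices in different blocks lie in at
  most one edge, so a Berge triangle, hence a whole Berge book, stays inside one block, which is too
  small.

  Upper bound: greedily, every pair \<open>u v\<close> in an edge has boundedly many \<open>w\<close> such that \<open>u w\<close> and \<open>v w\<close> are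
  covered by two different edges. This forces all but \<open>o(n\<^sup>2)\<close> edges into a rigid shape: the pairs of
  codegree at least 2 form an equivalence relation on the edge with exactly two classes, each of size
  at most \<open>t + 1\<close>. Hence an edge contains at least \<open>k (r - k)\<close> pairs of codegree 1. The graph of these
  pairs has few triangles on every edge, so it has at most \<open>n\<^sup>2/4 + O(n)\<close> edges.
  That at most two classes occur needs the Ruzsa-Szemeredi theorem: a graph all of whose edges lie in at
  most \<open>D\<close> triangles has \<open>o(n\<^sup>2)\<close> triangles. It is proved by an energy increment along partitions of the
  vertices according to their neighbours in a bounded vertex set.\<close>

subsection \<open>Conditional averages and their energy\<close>

text \<open>The obstacle: a triangle of pairs inside a single hyperedge is no Berge triangle, so
  freeness alone does not stop an edge from having three classes. For \<open>t = 1\<close>,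
  \<open>r = 3\<close> and all codegrees 1 this is the (6,3) problem. Three vertices from different
  classes are pairwise of codegree 1, and for every fixed \<open>C\<close> the graph of pairs of
  codegree below \<open>C\<close> has boundedly many triangles on each edge; this is what makes such
  hyperedges rare. Three parameters occur. \<open>M\<close> bounds ratios of codegrees,
  \<open>L\<close> is a codegree large enough for greedy embedding, and \<open>C = M * L\<close>.
  They depend on \<open>r\<close>, \<open>t\<close> and the error only, and \<open>n\<close> is
  taken large after them. The losses caused by \<open>M\<close> and \<open>L\<close> are small
  fractions of \<open>card H\<close>, not of \<open>n^2\<close>, so a crude bound
  \<open>card H = O(n^2)\<close> is proved beforehand. The constant: among splits of
  \<open>r\<close> into two parts of size between 1 and \<open>t + 1\<close> the product of the
  parts is least at the most uneven one, \<open>k\<close> and \<open>r - k\<close>. The condition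
  \<open>r <= 2 * t + 2\<close> makes \<open>r - k\<close> at most \<open>t + 1\<close>, so that
  this split is also available to the construction.\<close>

definition cond_avg :: "'a set \<Rightarrow> ('a \<Rightarrow> 'b) \<Rightarrow> ('a \<Rightarrow> real) \<Rightarrow> 'a \<Rightarrow> real" where
  "cond_avg S \<kappa> f p =
     (\<Sum>p' | p' \<in> S \<and> \<kappa> p' = \<kappa> p. f p') / real (card {p' \<in> S. \<kappa> p' = \<kappa> p})"

lemma cond_avg_cong: "\<kappa> p = \<kappa> p' \<Longrightarrow> cond_avg S \<kappa> f p = cond_avg S \<kappa> f p'"
  by (simp add: cond_avg_def)

text \<open>Conditional expectation moves past a factor that is constant on fibres: in the double
  sum each \<open>p'\<close> receives \<open>h p' * f p' / N p'\<close> once from each of the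
  \<open>N p'\<close> points of its fibre.\<close>

lemma sum_cond_avg:
  assumes S: "finite S"
    and h: "\<And>p p'. p \<in> S \<Longrightarrow> p' \<in> S \<Longrightarrow> \<kappa> p = \<kappa> p' \<Longrightarrow> h p = h p'"
  shows "(\<Sum>p\<in>S. h p * cond_avg S \<kappa> f p) = (\<Sum>p\<in>S. h p * f p)"
proof -
  define N where "N p = real (card {p' \<in> S. \<kappa> p' = \<kappa> p})" for p
  have Npos: "N p > 0" if "p \<in> S" for p
    unfolding N_def using S that by (auto simp: card_gt_0_iff)
  have "(\<Sum>p\<in>S. h p * cond_avg S \<kappa> f p)
      = (\<Sum>p\<in>S. \<Sum>p'\<in>S. if \<kappa> p' = \<kappa> p then h p * f p' / N p else 0)"
    unfolding cond_avg_def N_def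
    by (intro sum.cong refl)
      (simp add: sum.inter_filter[OF S, symmetric] sum_distrib_left sum_divide_distrib)
  also have "\<dots> = (\<Sum>p'\<in>S. \<Sum>p\<in>S. if \<kappa> p' = \<kappa> p then h p * f p' / N p else 0)"
    by (rule sum.swap)
  also have "\<dots> = (\<Sum>p'\<in>S. h p' * f p')"
  proof (rule sum.cong[OF refl])
    fix p' assume p': "p' \<in> S"
    have "(\<Sum>p\<in>S. if \<kappa> p' = \<kappa> p then h p * f p' / N p else 0)
        = (\<Sum>p\<in>S. if \<kappa> p = \<kappa> p' then h p' * f p' / N p' else 0)"
    proof (rule sum.cong[OF refl])
      fix p assume p: "p \<in> S"
      have "h p = h p' \<and> N p = N p'" if "\<kappa> p = \<kappa> p'"
        using h[OF p p' that] that by (simp add: N_def)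
      then show "(if \<kappa> p' = \<kappa> p then h p * f p' / N p else 0)
          = (if \<kappa> p = \<kappa> p' then h p' * f p' / N p' else 0)"
        by auto
    qed
    also have "\<dots> = N p' * (h p' * f p' / N p')"
      by (simp add: sum.inter_filter[OF S, symmetric] N_def)
    finally show "(\<Sum>p\<in>S. if \<kappa> p' = \<kappa> p then h p * f p' / N p else 0) = h p' * f p'"
      using Npos[OF p'] by simp
  qed
  finally show ?thesis .
qed

lemma cond_avg_bounds:
  assumes "finite S" and "\<And>p. p \<in> S \<Longrightarrow> 0 \<le> f p \<and> f p \<le> 1"
  shows "0 \<le> cond_avg S \<kappa> f p" "cond_avg S \<kappa> f p \<le> 1"
proof -
  show "0 \<le> cond_avg S \<kappa> f p"
    unfolding cond_avg_def using assms(2) by (auto intro!: divide_nonneg_nonneg sum_nonneg)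
  have "(\<Sum>p' | p' \<in> S \<and> \<kappa> p' = \<kappa> p. f p') \<le> (\<Sum>p' | p' \<in> S \<and> \<kappa> p' = \<kappa> p. 1)"
    using assms(2) by (intro sum_mono) auto
  then show "cond_avg S \<kappa> f p \<le> 1"
    unfolding cond_avg_def by (auto simp: divide_le_eq_1)
qed

text \<open>Averages over nested partitions are orthogonal projections, so by Pythagoras the gain is
  the squared distance of the two averages. On \<open>R\<close>, a union of finer fibres, the finer
  average has the same sum as \<open>f\<close>, at most half of what the coarser one has at
  least.\<close>

lemma cond_avg_energy_increment:
  assumes S: "finite S"
    and refine: "\<And>p p'. p \<in> S \<Longrightarrow> p' \<in> S \<Longrightarrow> \<kappa>' p = \<kappa>' p' \<Longrightarrow> \<kappa> p = \<kappa> p'"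
    and RS: "R \<subseteq> S"
    and meas: "\<And>p p'. p \<in> S \<Longrightarrow> p' \<in> S \<Longrightarrow> \<kappa>' p = \<kappa>' p' \<Longrightarrow> p \<in> R \<Longrightarrow> p' \<in> R"
    and big: "\<And>p. p \<in> R \<Longrightarrow> cond_avg S \<kappa> f p \<ge> \<delta>"
    and small: "(\<Sum>p\<in>R. f p) \<le> \<delta> / 2 * real (card R)"
    and \<delta>: "\<delta> \<ge> 0"
  shows "(\<Sum>p\<in>S. (cond_avg S \<kappa>' f p)\<^sup>2) \<ge>
         (\<Sum>p\<in>S. (cond_avg S \<kappa> f p)\<^sup>2) + \<delta>\<^sup>2 / 4 * real (card R)"
proof -
  define g where "g = cond_avg S \<kappa> f"
  define g' where "g' = cond_avg S \<kappa>' f"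
  have g_cong: "g p = g p'" if "p \<in> S" "p' \<in> S" "\<kappa>' p = \<kappa>' p'" for p p'
    unfolding g_def using refine[OF that] by (rule cond_avg_cong)
  have e1: "(\<Sum>p\<in>S. g p * g' p) = (\<Sum>p\<in>S. g p * f p)"
    unfolding g'_def by (intro sum_cond_avg S) (rule g_cong)
  have e2: "(\<Sum>p\<in>S. g p * g p) = (\<Sum>p\<in>S. g p * f p)"
    unfolding g_def by (intro sum_cond_avg S) (rule cond_avg_cong)
  have "(\<Sum>p\<in>S. (g p - g' p)\<^sup>2) =
        (\<Sum>p\<in>S. (g' p)\<^sup>2) - 2 * (\<Sum>p\<in>S. g p * g' p) + (\<Sum>p\<in>S. g p * g p)"
    by (simp add: power2_diff sum.distrib sum_subtractf sum_distrib_left power2_eq_square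
        algebra_simps)
  then have pyth: "(\<Sum>p\<in>S. (g' p)\<^sup>2) = (\<Sum>p\<in>S. (g p)\<^sup>2) + (\<Sum>p\<in>S. (g p - g' p)\<^sup>2)"
    using e1 e2 by (simp add: power2_eq_square)
  have fR: "finite R" using S RS finite_subset by blast
  have "(\<Sum>p\<in>S. (if p \<in> R then 1 else 0) * g' p) = (\<Sum>p\<in>S. (if p \<in> R then 1 else 0) * f p)"
    unfolding g'_def by (intro sum_cond_avg S) (use meas in metis)
  then have "(\<Sum>p\<in>R. g' p) = (\<Sum>p\<in>R. f p)"
    using S RS by (simp add: if_distrib[of "\<lambda>x. x * _"] sum.inter_restrict[symmetric] Int_absorb1 cong: if_cong)
  moreover have "(\<Sum>p\<in>R. g p) \<ge> \<delta> * real (card R)"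
    using sum_mono[of R "\<lambda>_. \<delta>" g] big by (simp add: g_def mult.commute)
  ultimately have diff: "(\<Sum>p\<in>R. g p - g' p) \<ge> \<delta> / 2 * real (card R)"
    using small by (simp add: sum_subtractf)
  \<comment> \<open>In place of Cauchy-Schwarz: the tangent bound
    \<open>x^2 >= \<delta> * x - \<delta>^2 / 4\<close> is linear in \<open>x\<close> and can be
    summed over \<open>R\<close>.\<close>
  have "\<delta> * (\<Sum>p\<in>R. g p - g' p) - \<delta>\<^sup>2 / 4 * real (card R)
      = (\<Sum>p\<in>R. \<delta> * (g p - g' p) - \<delta>\<^sup>2 / 4)"
    by (simp add: sum_subtractf sum_distrib_left right_diff_distrib)
  also have "\<dots> \<le> (\<Sum>p\<in>R. (g p - g' p)\<^sup>2)"
  proof (rule sum_mono)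
    fix p
    have "0 \<le> (g p - g' p - \<delta> / 2)\<^sup>2" by simp
    then show "\<delta> * (g p - g' p) - \<delta>\<^sup>2 / 4 \<le> (g p - g' p)\<^sup>2"
      by (simp add: power2_eq_square algebra_simps)
  qed
  also have "\<dots> \<le> (\<Sum>p\<in>S. (g p - g' p)\<^sup>2)"
    using S RS by (intro sum_mono2) auto
  finally have "(\<Sum>p\<in>S. (g p - g' p)\<^sup>2) \<ge> \<delta> * (\<Sum>p\<in>R. g p - g' p) - \<delta>\<^sup>2 / 4 * real (card R)" .
  moreover have "\<delta> * (\<Sum>p\<in>R. g p - g' p) \<ge> \<delta> * (\<delta> / 2 * real (card R))"
    using diff \<delta> by (intro mult_left_mono)
  ultimately show ?thesis
    using pyth unfolding g_def g'_def by (simp add: power2_eq_square)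
qed


subsection \<open>Graphs with few triangles on every edge\<close>

lemma card_le_fibres:
  assumes "finite P" and "finite A" and "\<And>a. a \<in> A \<Longrightarrow> \<pi> a \<in> P"
    and "\<And>p. p \<in> P \<Longrightarrow> card {a \<in> A. \<pi> a = p} \<le> c"
  shows "card A \<le> c * card P"
proof -
  have "card A = (\<Sum>p\<in>P. card {a \<in> A. \<pi> a = p})"
    using sum.group[of A P \<pi> "\<lambda>_. 1::nat"] assms by (simp add: image_subset_iff)
  also have "\<dots> \<le> (\<Sum>p\<in>P. c)"
    by (intro sum_mono assms)
  finally show ?thesis by (simp add: mult.commute)
qed

locale few_triangles =
  fixes V :: "'a set" and E :: "'a \<Rightarrow> 'a \<Rightarrow> bool" and D :: nat
  assumes finite_V: "finite V"
    and sym: "E x y \<Longrightarrow> E y x"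
    and codegree: "x \<in> V \<Longrightarrow> y \<in> V \<Longrightarrow> E x y \<Longrightarrow> card {z \<in> V. E x z \<and> E y z} \<le> D"
begin

definition triangles :: "('a \<times> 'a \<times> 'a) set" where
  "triangles = {(x, y, z). x \<in> V \<and> y \<in> V \<and> z \<in> V \<and> E x y \<and> E x z \<and> E y z}"

text \<open>The neighbours inside \<open>Z\<close> serve as the label of a vertex: equal labels form
  a cell, there are at most \<open>2 ^ card Z\<close> cells, and enlarging \<open>Z\<close> refines
  them.\<close>

definition nbs :: "'a set \<Rightarrow> 'a \<Rightarrow> 'a set" where
  "nbs Z x = {z \<in> Z. E z x}"

definition cell :: "'a set \<Rightarrow> 'a \<Rightarrow> 'a set" where
  "cell Z x = {x' \<in> V. nbs Z x' = nbs Z x}"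

definition adj :: "'a \<times> 'a \<Rightarrow> real" where
  "adj = (\<lambda>(x, y). of_bool (E x y))"

definition colour :: "'a set \<Rightarrow> 'a \<times> 'a \<Rightarrow> 'a set \<times> 'a set" where
  "colour Z = (\<lambda>(x, y). (nbs Z x, nbs Z y))"

text \<open>On \<open>V \<times> V\<close> this is the edge density between the cell of the first
  and the cell of the second coordinate.\<close>

definition density :: "'a set \<Rightarrow> 'a \<times> 'a \<Rightarrow> real" where
  "density Z = cond_avg (V \<times> V) (colour Z) adj"

text \<open>The index known from Szemeredi's regularity lemma, not normalised: it ranges up to the
  square of \<open>card V\<close>.\<close>

definition energy :: "'a set \<Rightarrow> real" where
  "energy Z = (\<Sum>p\<in>V \<times> V. (density Z p)\<^sup>2)"

lemma finite_triangles: "finite triangles"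
  by (rule finite_subset[of _ "V \<times> V \<times> V"]) (auto simp: triangles_def finite_V)

lemma energy_le: "energy Z \<le> (real (card V))\<^sup>2"
proof -
  have "(density Z p)\<^sup>2 \<le> 1" for p
    unfolding density_def
    using cond_avg_bounds[of "V \<times> V" adj "colour Z" p] finite_V
    by (auto simp: adj_def abs_square_le_1)
  then have "energy Z \<le> (\<Sum>p\<in>V \<times> V. 1)"
    unfolding energy_def by (intro sum_mono)
  then show ?thesis by (simp add: card_cartesian_product power2_eq_square)
qed

lemma energy_nonneg: "energy Z \<ge> 0"
  unfolding energy_def by (intro sum_nonneg) auto

lemma card_triangles_over_xy:
  assumes "A \<subseteq> triangles" "finite P" "\<And>x y z. (x, y, z) \<in> A \<Longrightarrow> (x, y) \<in> P"
  shows "card A \<le> D * card P"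
proof (rule card_le_fibres[where \<pi> = "\<lambda>(x, y, z). (x, y)"])
  show finA: "finite A" using assms(1) finite_triangles finite_subset by blast
  fix p assume "p \<in> P"
  obtain x y where p: "p = (x, y)" by force
  show "card {a \<in> A. (case a of (x, y, z) \<Rightarrow> (x, y)) = p} \<le> D"
  proof (cases "x \<in> V \<and> y \<in> V \<and> E x y")
    case True
    have "{a \<in> A. (case a of (x, y, z) \<Rightarrow> (x, y)) = p} \<subseteq>
        (\<lambda>z. (x, y, z)) ` {z \<in> V. E x z \<and> E y z}"
      using assms(1) p by (auto simp: triangles_def)
    from surj_card_le[OF _ this] codegree[of x y] True finite_V show ?thesis by force
  next
    case False
    then have "{a \<in> A. (case a of (x, y, z) \<Rightarrow> (x, y)) = p} = {}"
      using assms(1) p by (auto simp: triangles_def)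
    then show ?thesis by (simp only: card.empty)
  qed
qed (use assms in auto)

lemma card_triangles_over_xz:
  assumes "A \<subseteq> triangles" "finite P" "\<And>x y z. (x, y, z) \<in> A \<Longrightarrow> (x, z) \<in> P"
  shows "card A \<le> D * card P"
proof -
  define s :: "'a \<times> 'a \<times> 'a \<Rightarrow> 'a \<times> 'a \<times> 'a" where "s = (\<lambda>(x, y, z). (x, z, y))"
  have "card (s ` A) = card A"
    by (intro card_image inj_onI) (auto simp: s_def)
  moreover have "card (s ` A) \<le> D * card P"
    by (intro card_triangles_over_xy) (use assms in \<open>auto simp: triangles_def s_def intro: sym\<close>)
  ultimately show ?thesis by simp
qed

lemma card_triangles_over_yz:
  assumes "A \<subseteq> triangles" "finite P" "\<And>x y z. (x, y, z) \<in> A \<Longrightarrow> (y, z) \<in> P"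
  shows "card A \<le> D * card P"
proof -
  define s :: "'a \<times> 'a \<times> 'a \<Rightarrow> 'a \<times> 'a \<times> 'a" where "s = (\<lambda>(x, y, z). (y, z, x))"
  have "card (s ` A) = card A"
    by (intro card_image inj_onI) (auto simp: s_def)
  moreover have "card (s ` A) \<le> D * card P"
    by (intro card_triangles_over_xy) (use assms in \<open>auto simp: triangles_def s_def intro: sym\<close>)
  ultimately show ?thesis by simp
qed

text \<open>The pairs of low density form a union of blocks, so \<open>adj\<close> and
  \<open>density\<close> have the same sum over them.\<close>

lemma card_sparse_pairs:
  assumes "\<delta> \<ge> 0"
  shows "real (card {p \<in> V \<times> V. adj p = 1 \<and> density Z p < \<delta>}) \<le> \<delta> * (real (card V))\<^sup>2"
proof -
  define h :: "'a \<times> 'a \<Rightarrow> real" where "h p = of_bool (density Z p < \<delta>)" for p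
  have "real (card {p \<in> V \<times> V. adj p = 1 \<and> density Z p < \<delta>})
      = (\<Sum>p\<in>V \<times> V. of_bool (adj p = 1 \<and> density Z p < \<delta>))"
    using finite_V by (simp add: Int_def)
  also have "\<dots> = (\<Sum>p\<in>V \<times> V. h p * adj p)"
    by (intro sum.cong refl) (auto simp: h_def adj_def)
  also have "\<dots> = (\<Sum>p\<in>V \<times> V. h p * density Z p)"
    unfolding density_def
    by (rule sum_cond_avg[symmetric])
      (auto simp: finite_V h_def density_def dest!: cond_avg_cong[of "colour Z" _ _ "V \<times> V" adj])
  also have "\<dots> \<le> (\<Sum>p\<in>V \<times> V. \<delta>)"
    using assms by (intro sum_mono) (auto simp: h_def)
  also have "\<dots> = \<delta> * (real (card V))\<^sup>2"
    by (simp add: card_cartesian_product power2_eq_square)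
  finally show ?thesis .
qed

lemma card_small_cells:
  assumes "finite Z"
  shows "card {y \<in> V. card (cell Z y) < b} \<le> b * 2 ^ card Z"
proof -
  have "card {y \<in> V. card (cell Z y) < b} \<le> b * card (Pow Z)"
  proof (rule card_le_fibres[where \<pi> = "nbs Z"])
    fix c
    show "card {a \<in> {y \<in> V. card (cell Z y) < b}. nbs Z a = c} \<le> b" (is "card ?F \<le> b")
    proof (cases "?F = {}")
      case False
      then obtain y where y: "y \<in> V" "card (cell Z y) < b" "nbs Z y = c" by auto
      then have "?F \<subseteq> cell Z y" by (auto simp: cell_def)
      then have "card ?F \<le> card (cell Z y)"
        using finite_V by (intro card_mono) (auto simp: cell_def)
      then show ?thesis using y by simp
    qed (metis card.empty le0)
  qed (use assms finite_V in \<open>auto simp: nbs_def\<close>)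
  then show ?thesis using assms by (simp add: card_Pow)
qed

text \<open>Within one cell the set is either empty or contained in the neighbourhood of
  \<open>z\<close> there, which then is less than an \<alpha>-fraction of the cell. Summing over
  cells gives the bound.\<close>

lemma card_atypical_nbs:
  assumes "\<alpha> \<ge> 0"
  shows "real (card {x \<in> V. E z x \<and> real (card {x' \<in> cell Z x. E z x'}) < \<alpha> * real (card (cell Z x))})
         \<le> \<alpha> * real (card V)" (is "real (card ?B) \<le> _")
proof -
  have "real (card ?B) = (\<Sum>c\<in>nbs Z ` V. real (card {x \<in> ?B. nbs Z x = c}))"
    using sum.group[of ?B "nbs Z ` V" "nbs Z" "\<lambda>_. 1::real"] finite_V by (auto simp: image_subset_iff)
  also have "\<dots> \<le> (\<Sum>c\<in>nbs Z ` V. \<alpha> * real (card {x \<in> V. nbs Z x = c}))"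
  proof (rule sum_mono)
    fix c
    show "real (card {x \<in> ?B. nbs Z x = c}) \<le> \<alpha> * real (card {x \<in> V. nbs Z x = c})" (is "real (card ?F) \<le> _")
    proof (cases "?F = {}")
      case False
      then obtain x where x: "x \<in> ?B" "nbs Z x = c" by auto
      then have "?F \<subseteq> {x' \<in> cell Z x. E z x'}" by (auto simp: cell_def)
      then have "card ?F \<le> card {x' \<in> cell Z x. E z x'}"
        using finite_V by (intro card_mono) (auto simp: cell_def)
      then show ?thesis using x by (auto simp: cell_def)
    qed (use assms in \<open>metis card.empty of_nat_0 of_nat_0_le_iff mult_nonneg_nonneg\<close>)
  qed
  also have "\<dots> = \<alpha> * real (card V)"
    using sum.group[of V "nbs Z ` V" "nbs Z" "\<lambda>_. 1::real"] finite_V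
    by (simp add: sum_distrib_left[symmetric])
  finally show ?thesis .
qed

text \<open>Drop the triangles in sparse blocks, those with a small cell of \<open>y\<close>, and
  those whose third vertex \<open>z\<close> sees too little of the cell of \<open>x\<close> or
  \<open>y\<close>. In a surviving block the neighbourhoods of \<open>z\<close> in the two cells are
  large and span almost no edges, because each such edge closes a triangle with \<open>z\<close>.
  Adding \<open>z\<close> to \<open>Z\<close> cuts this thin rectangle out of a block of density at
  least \<delta>.\<close>

lemma energy_step:
  fixes \<epsilon> :: real and m :: nat
  assumes \<epsilon>: "\<epsilon> > 0" and D: "D > 0" and Z: "Z \<subseteq> V" "card Z \<le> m"
    and T: "real (card triangles) \<ge> \<epsilon> * (real (card V))\<^sup>2"
    and \<delta>_def: "\<delta> = \<epsilon> / (8 * real D)" and \<alpha>_def: "\<alpha> = \<epsilon> / (16 * real D)"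
    and b: "real b * (\<alpha> * \<delta>) \<ge> 2 * real D"
    and large: "\<epsilon> * real (card V) \<ge> 8 * real D * real b * 2 ^ m"
  shows "\<exists>Z'\<subseteq>V. card Z' \<le> m + 4 ^ m \<and>
    energy Z' \<ge> energy Z + \<alpha>\<^sup>2 * \<epsilon> / (2 * real D) * \<delta>\<^sup>2 / 4 * (real (card V))\<^sup>2"
proof -
  define N where "N = real (card V)"
  have fZ: "finite Z" using Z finite_V finite_subset by blast
  have pos: "\<delta> > 0" "\<alpha> > 0" using \<epsilon> D by (auto simp: \<delta>_def \<alpha>_def)
  define nb where "nb z x = {x' \<in> cell Z x. E z x'}" for z x
  define atyp where "atyp z x \<longleftrightarrow> real (card (nb z x)) < \<alpha> * real (card (cell Z x))" for z x
  define G where "G = {(x, y, z) \<in> triangles. density Z (x, y) \<ge> \<delta> \<and> card (cell Z y) \<ge> b \<and>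
    \<not> atyp z x \<and> \<not> atyp z y}"
  define B1 where "B1 = {(x, y, z) \<in> triangles. density Z (x, y) < \<delta>}"
  define B2 where "B2 = {(x, y, z) \<in> triangles. card (cell Z y) < b}"
  define B3 where "B3 = {(x, y, z) \<in> triangles. atyp z x}"
  define B4 where "B4 = {(x, y, z) \<in> triangles. atyp z y}"
  have cover: "triangles \<subseteq> G \<union> (B1 \<union> (B2 \<union> (B3 \<union> B4)))"
    by (auto simp: G_def B1_def B2_def B3_def B4_def)
  have fins: "finite G" "finite B1" "finite B2" "finite B3" "finite B4"
    by (auto intro!: finite_subset[OF _ finite_triangles] simp: G_def B1_def B2_def B3_def B4_def)
  have card_cover: "card triangles \<le> card G + (card B1 + (card B2 + (card B3 + card B4)))"
    using card_mono[OF _ cover] fins card_Un_le[of G "B1 \<union> (B2 \<union> (B3 \<union> B4))"]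
      card_Un_le[of B1 "B2 \<union> (B3 \<union> B4)"] card_Un_le[of B2 "B3 \<union> B4"] card_Un_le[of B3 B4]
    by simp
  have B1: "real (card B1) \<le> \<epsilon> / 8 * N\<^sup>2"
  proof -
    let ?P = "{p \<in> V \<times> V. adj p = 1 \<and> density Z p < \<delta>}"
    have "card B1 \<le> D * card ?P"
      by (rule card_triangles_over_xy) (auto simp: B1_def triangles_def adj_def finite_V)
    then have "real (card B1) \<le> real D * real (card ?P)"
      unfolding of_nat_mult[symmetric] of_nat_le_iff .
    also have "\<dots> \<le> real D * (\<delta> * N\<^sup>2)"
      unfolding N_def using pos by (intro mult_left_mono card_sparse_pairs) auto
    finally show ?thesis using D by (simp add: \<delta>_def)
  qed
  have B2: "real (card B2) \<le> \<epsilon> / 8 * N\<^sup>2"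
  proof -
    let ?S = "{y \<in> V. card (cell Z y) < b}"
    have "card B2 \<le> D * card (V \<times> ?S)"
      by (rule card_triangles_over_xy) (auto simp: B2_def triangles_def finite_V)
    also have "\<dots> \<le> D * (card V * (b * 2 ^ m))"
    proof -
      have "card ?S \<le> b * 2 ^ card Z" by (rule card_small_cells[OF fZ])
      also have "\<dots> \<le> b * 2 ^ m" using Z by simp
      finally show ?thesis by (simp add: card_cartesian_product)
    qed
    finally have "real (card B2) \<le> real (D * (card V * (b * 2 ^ m)))" by (simp only: of_nat_le_iff)
    also have "\<dots> = N / 8 * (8 * real D * real b * 2 ^ m)" by (simp add: N_def)
    also have "\<dots> \<le> N / 8 * (\<epsilon> * N)"
      using large unfolding N_def by (intro mult_left_mono) auto
    finally show ?thesis by (simp add: power2_eq_square mult_ac)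
  qed
  define Q where "Q = {(z, x) \<in> V \<times> V. E z x \<and> atyp z x}"
  \<comment> \<open>Triangles list the witness \<open>z\<close> last, so the pairs are reversed
    before the fibre bounds over \<open>(x, z)\<close> and \<open>(y, z)\<close> are
    applied.\<close>
  define Q' where "Q' = (\<lambda>(z, x). (x, z)) ` Q"
  have "finite Q" by (rule finite_subset[of _ "V \<times> V"]) (auto simp: Q_def finite_V)
  then have fQ': "finite Q'" and Q_le: "card Q' \<le> card Q"
    by (auto simp: Q'_def card_image_le)
  have "real (card Q) \<le> \<alpha> * N\<^sup>2"
  proof -
    have "Q = (SIGMA z:V. {x \<in> V. E z x \<and> atyp z x})" by (auto simp: Q_def)
    then have "real (card Q)
        = (\<Sum>z\<in>V. real (card {x \<in> V. E z x \<and> atyp z x}))"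
      using finite_V by simp
    also have "\<dots> \<le> (\<Sum>z\<in>V. \<alpha> * N)"
      unfolding N_def atyp_def nb_def using pos by (intro sum_mono card_atypical_nbs) auto
    finally show ?thesis by (simp add: N_def power2_eq_square mult_ac)
  qed
  then have atyp: "real (card Q') \<le> \<alpha> * N\<^sup>2" using Q_le by linarith
  have B3: "real (card B3) \<le> \<epsilon> / 16 * N\<^sup>2"
  proof -
    have "card B3 \<le> D * card Q'"
      by (rule card_triangles_over_xz)
        (use fQ' in \<open>auto simp: B3_def triangles_def Q'_def Q_def image_iff intro: sym\<close>)
    then have "real (card B3) \<le> real D * real (card Q')"
      unfolding of_nat_mult[symmetric] of_nat_le_iff .
    also have "\<dots> \<le> real D * (\<alpha> * N\<^sup>2)"
      by (intro mult_left_mono atyp) auto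
    finally show ?thesis using D by (simp add: \<alpha>_def)
  qed
  have B4: "real (card B4) \<le> \<epsilon> / 16 * N\<^sup>2"
  proof -
    have "card B4 \<le> D * card Q'"
      by (rule card_triangles_over_yz)
        (use fQ' in \<open>auto simp: B4_def triangles_def Q'_def Q_def image_iff intro: sym\<close>)
    then have "real (card B4) \<le> real D * real (card Q')"
      unfolding of_nat_mult[symmetric] of_nat_le_iff .
    also have "\<dots> \<le> real D * (\<alpha> * N\<^sup>2)"
      by (intro mult_left_mono atyp) auto
    finally show ?thesis using D by (simp add: \<alpha>_def)
  qed
  have "real (card triangles) \<le> real (card G) + (real (card B1) + (real (card B2) + (real (card B3) + real (card B4))))"
    using card_cover by (simp only: of_nat_add[symmetric] of_nat_le_iff)
  \<comment> \<open>The four losses are 1/8, 1/8, 1/16 and 1/16 of \<open>\<epsilon> * N^2\<close>,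
    less than half in total; \<delta> and \<alpha> are chosen for this.\<close>
  then have G_big: "real (card G) \<ge> \<epsilon> / 2 * N\<^sup>2"
    using T B1 B2 B3 B4 \<epsilon> mult_nonneg_nonneg[of \<epsilon> "N\<^sup>2"] unfolding N_def[symmetric] by simp
  define P where "P = (\<lambda>(x, y, z). (x, y)) ` G"
  have P_sub: "P \<subseteq> V \<times> V" by (auto simp: P_def G_def triangles_def)
  then have fP: "finite P" using finite_V finite_subset by blast
  have "card G \<le> D * card P"
    by (rule card_triangles_over_xy) (use fP in \<open>force simp: P_def G_def\<close>)+
  then have "real (card G) \<le> real D * real (card P)" unfolding of_nat_mult[symmetric] of_nat_le_iff .
  then have P_big: "real (card P) \<ge> \<epsilon> / (2 * real D) * N\<^sup>2"
    using G_big D by (simp add: field_simps)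
  define Sel where "Sel = colour Z ` P"
  have fSel: "finite Sel" using fP by (simp add: Sel_def)
  have "\<forall>k\<in>Sel. \<exists>x y z. (x, y, z) \<in> G \<and> colour Z (x, y) = k"
    by (auto simp: Sel_def P_def)
  \<comment> \<open>One representative triangle per block is enough. There are at most
    \<open>4 ^ m\<close> blocks, which is the growth allowed for \<open>Z'\<close>.\<close>
  then obtain X Y W where XYW: "\<And>k. k \<in> Sel \<Longrightarrow> (X k, Y k, W k) \<in> G \<and> colour Z (X k, Y k) = k"
    by metis
  define Z' where "Z' = Z \<union> W ` Sel"
  have Z'V: "Z' \<subseteq> V" using Z XYW by (force simp: Z'_def G_def triangles_def)
  have card_Z': "card Z' \<le> m + 4 ^ m"
  proof -
    have "Sel \<subseteq> Pow Z \<times> Pow Z" by (auto simp: Sel_def colour_def nbs_def)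
    then have "card Sel \<le> card (Pow Z \<times> Pow Z)" using fZ by (intro card_mono) auto
    also have "\<dots> = 4 ^ card Z" using fZ by (simp add: card_cartesian_product card_Pow power_mult_distrib[symmetric])
    also have "\<dots> \<le> 4 ^ m" using Z by simp
    finally have "card (W ` Sel) \<le> 4 ^ m" using card_image_le[OF fSel, of W] by linarith
    then show ?thesis unfolding Z'_def using card_Un_le[of Z "W ` Sel"] Z by linarith
  qed
  \<comment> \<open>In each selected block, the rectangle of the two neighbourhoods of its chosen
    vertex. As that vertex belongs to \<open>Z'\<close>, membership in \<open>R\<close> is decided
    by the new colours.\<close>
  define R where "R = {p \<in> V \<times> V. colour Z p \<in> Sel \<and> E (W (colour Z p)) (fst p) \<and> E (W (colour Z p)) (snd p)}"
  have fR: "finite R" by (rule finite_subset[of _ "V \<times> V"]) (auto simp: R_def finite_V)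
  define blk where "blk k = {p \<in> V \<times> V. colour Z p = k}" for k
  have fblk: "finite (blk k)" for k by (rule finite_subset[of _ "V \<times> V"]) (auto simp: blk_def finite_V)
  have block: "real (card {p \<in> R. colour Z p = k}) \<ge> \<alpha>\<^sup>2 * real (card (blk k)) \<and>
      (\<Sum>p | p \<in> R \<and> colour Z p = k. adj p) \<le> \<delta> / 2 * real (card {p \<in> R. colour Z p = k})"
    if k: "k \<in> Sel" for k
  proof -
    define x y z where "x = X k" and "y = Y k" and "z = W k"
    have G: "(x, y, z) \<in> G" and col: "k = (nbs Z x, nbs Z y)"
      using XYW[OF k] by (auto simp: x_def y_def z_def colour_def)
    have xyz: "x \<in> V" "y \<in> V" "z \<in> V" using G by (auto simp: G_def triangles_def)
    define A B where "A = nb z x" and "B = nb z y"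
    have AV: "A \<subseteq> V" "B \<subseteq> V" by (auto simp: A_def B_def nb_def cell_def)
    have fAB: "finite A" "finite B" using AV finite_V finite_subset by blast+
    have blk_eq: "blk k = cell Z x \<times> cell Z y"
      by (auto simp: blk_def cell_def col colour_def)
    have R_eq: "{p \<in> R. colour Z p = k} = A \<times> B"
      using k by (auto simp: R_def cell_def col colour_def A_def B_def nb_def z_def)
    have A_big: "real (card A) \<ge> \<alpha> * real (card (cell Z x))"
      and B_big: "real (card B) \<ge> \<alpha> * real (card (cell Z y))"
      and b_le: "b \<le> card (cell Z y)"
      using G by (auto simp: G_def atyp_def A_def B_def)
    have 1: "real (card (A \<times> B)) \<ge> \<alpha>\<^sup>2 * real (card (blk k))"
      using mult_mono[OF A_big B_big] pos
      by (simp add: blk_eq card_cartesian_product power2_eq_square mult_ac)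
    have "(\<Sum>p\<in>A \<times> B. adj p) = (\<Sum>x'\<in>A. \<Sum>y'\<in>B. of_bool (E x' y'))"
      by (simp add: adj_def sum.cartesian_product)
    also have "\<dots> \<le> (\<Sum>x'\<in>A. \<delta> / 2 * real (card B))"
    proof (rule sum_mono)
      fix x' assume x': "x' \<in> A"
      then have zx: "E z x'" "x' \<in> V" using AV by (auto simp: A_def nb_def)
      have "(\<Sum>y'\<in>B. of_bool (E x' y')) = real (card {y' \<in> B. E x' y'})"
        using fAB by (simp add: Int_def)
      \<comment> \<open>All of \<open>B\<close> is adjacent to \<open>z\<close>, so a neighbour of
        \<open>x'\<close> in \<open>B\<close> is a common neighbour of \<open>z\<close> and
        \<open>x'\<close>, of which there are at most \<open>D\<close>. The condition on
        \<open>b\<close> makes \<open>D\<close> small against \<open>card B\<close>.\<close>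
      also have "card {y' \<in> B. E x' y'} \<le> card {y' \<in> V. E z y' \<and> E x' y'}"
        using AV by (intro card_mono) (auto simp: finite_V B_def nb_def)
      also have "\<dots> \<le> D" using codegree zx xyz by blast
      also have "real D \<le> \<delta> / 2 * (\<alpha> * real b)" using b by (simp add: mult_ac)
      also have "\<dots> \<le> \<delta> / 2 * (\<alpha> * real (card (cell Z y)))"
        using b_le pos by (intro mult_left_mono) auto
      also have "\<dots> \<le> \<delta> / 2 * real (card B)"
        using B_big pos by (intro mult_left_mono) auto
      finally show "(\<Sum>y'\<in>B. of_bool (E x' y')) \<le> \<delta> / 2 * real (card B)" by simp
    qed
    also have "\<dots> = \<delta> / 2 * real (card (A \<times> B))"
      by (simp add: card_cartesian_product)
    finally show ?thesis using 1 by (simp add: R_eq)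
  qed
  have R_sel: "colour Z ` R \<subseteq> Sel" by (auto simp: R_def)
  have card_R: "real (card R) \<ge> \<alpha>\<^sup>2 * real (card P)"
  proof -
    have "P \<subseteq> (\<Union>k\<in>Sel. blk k)" using P_sub by (auto simp: Sel_def blk_def)
    then have "card P \<le> card (\<Union>k\<in>Sel. blk k)" using fSel fblk by (intro card_mono) auto
    also have "\<dots> \<le> (\<Sum>k\<in>Sel. card (blk k))" using fSel by (rule card_UN_le)
    finally have "\<alpha>\<^sup>2 * real (card P) \<le> \<alpha>\<^sup>2 * real (\<Sum>k\<in>Sel. card (blk k))"
      by (intro mult_left_mono) (simp_all only: of_nat_le_iff zero_le_power2)
    also have "\<dots> = (\<Sum>k\<in>Sel. \<alpha>\<^sup>2 * real (card (blk k)))" by (simp add: sum_distrib_left)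
    also have "\<dots> \<le> (\<Sum>k\<in>Sel. real (card {p \<in> R. colour Z p = k}))"
      using block by (intro sum_mono) auto
    also have "\<dots> = real (card R)"
      using sum.group[OF fR fSel R_sel, of "\<lambda>_. 1::real"] by simp
    finally show ?thesis .
  qed
  have adj_R: "(\<Sum>p\<in>R. adj p) \<le> \<delta> / 2 * real (card R)"
  proof -
    have "(\<Sum>p\<in>R. adj p) = (\<Sum>k\<in>Sel. \<Sum>p | p \<in> R \<and> colour Z p = k. adj p)"
      using sum.group[OF fR fSel R_sel, of adj] by simp
    also have "\<dots> \<le> (\<Sum>k\<in>Sel. \<delta> / 2 * real (card {p \<in> R. colour Z p = k}))"
      using block by (intro sum_mono) auto
    also have "\<dots> = \<delta> / 2 * real (card R)"
      using sum.group[OF fR fSel R_sel, of "\<lambda>_. 1::real"] unfolding sum_distrib_left[symmetric]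
      by simp
    finally show ?thesis .
  qed
  have nbs_Z': "nbs Z x = nbs Z x' \<and> (\<forall>z\<in>Z'. E z x \<longleftrightarrow> E z x')" if "nbs Z' x = nbs Z' x'" for x x'
    using that by (auto simp: nbs_def Z'_def set_eq_iff)
  have ref: "colour Z p = colour Z p'" if "colour Z' p = colour Z' p'" for p p'
    using that nbs_Z'[of "fst p" "fst p'"] nbs_Z'[of "snd p" "snd p'"]
    by (simp add: colour_def split_beta)
  have incr: "(\<Sum>p\<in>V \<times> V. (density Z' p)\<^sup>2) \<ge>
         (\<Sum>p\<in>V \<times> V. (density Z p)\<^sup>2) + \<delta>\<^sup>2 / 4 * real (card R)"
    unfolding density_def
  proof (rule cond_avg_energy_increment)
    fix p p' assume p: "p \<in> V \<times> V" "p' \<in> V \<times> V" "colour Z' p = colour Z' p'" "p \<in> R"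
    have eq: "colour Z p = colour Z p'" using ref p by blast
    have "W (colour Z p) \<in> Z'" using p by (auto simp: R_def Z'_def)
    then have "E (W (colour Z p)) (fst p) \<longleftrightarrow> E (W (colour Z p)) (fst p')"
        "E (W (colour Z p)) (snd p) \<longleftrightarrow> E (W (colour Z p)) (snd p')"
      using p(3) nbs_Z'[of "fst p" "fst p'"] nbs_Z'[of "snd p" "snd p'"]
      by (simp_all add: colour_def split_beta)
    then show "p' \<in> R" using p eq by (auto simp: R_def)
  next
    fix p assume "p \<in> R"
    then have k: "colour Z p \<in> Sel" by (auto simp: R_def)
    have "density Z (X (colour Z p), Y (colour Z p)) \<ge> \<delta>"
      using XYW[OF k] by (auto simp: G_def)
    moreover have "density Z (X (colour Z p), Y (colour Z p)) = density Z p"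
      unfolding density_def using XYW[OF k] by (intro cond_avg_cong) auto
    ultimately show "\<delta> \<le> cond_avg (V \<times> V) (colour Z) adj p"
      by (simp add: density_def)
  next
    show "R \<subseteq> V \<times> V" by (auto simp: R_def)
    show "colour Z p = colour Z p'" if "colour Z' p = colour Z' p'" for p p'
      using that by (rule ref)
  qed (use adj_R pos finite_V in simp_all)
  have "\<alpha>\<^sup>2 * \<epsilon> / (2 * real D) * \<delta>\<^sup>2 / 4 * N\<^sup>2 = \<delta>\<^sup>2 / 4 * (\<alpha>\<^sup>2 * (\<epsilon> / (2 * real D) * N\<^sup>2))"
    by simp
  also have "\<dots> \<le> \<delta>\<^sup>2 / 4 * (\<alpha>\<^sup>2 * real (card P))"
    by (intro mult_left_mono P_big) auto
  also have "\<dots> \<le> \<delta>\<^sup>2 / 4 * real (card R)"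
    by (intro mult_left_mono card_R) auto
  finally have "energy Z' \<ge> energy Z + \<alpha>\<^sup>2 * \<epsilon> / (2 * real D) * \<delta>\<^sup>2 / 4 * N\<^sup>2"
    using incr unfolding energy_def by linarith
  then show ?thesis using Z'V card_Z' unfolding N_def by blast
qed

end

section \<open>The Ruzsa-Szemeredi theorem by iteration\<close>

text \<open>If the bound fails, every step adds \<open>\<eta>\<close> times the square of
  \<open>card V\<close> to the energy, which cannot exceed that square; more than
  \<open>1 / \<eta>\<close> steps are contradictory. The threshold \<open>N\<close> is uniform over
  all graphs, as needed for the codegree graphs, which change with \<open>n\<close>.\<close>

lemma few_triangles_per_edge:
  fixes \<epsilon> :: real
  assumes \<epsilon>: "\<epsilon> > 0"
  obtains N where "\<And>(V :: 'a set) E. few_triangles V E D \<Longrightarrow> card V \<ge> N \<Longrightarrow>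
           real (card (few_triangles.triangles V E)) \<le> \<epsilon> * (real (card V))\<^sup>2"
proof -
  \<comment> \<open>The successor keeps the divisors positive when \<open>D = 0\<close>.\<close>
  define D' where "D' = Suc D"
  define \<delta> where "\<delta> = \<epsilon> / (8 * real D')"
  define \<alpha> where "\<alpha> = \<epsilon> / (16 * real D')"
  define \<eta> where "\<eta> = \<alpha>\<^sup>2 * \<epsilon> / (2 * real D') * \<delta>\<^sup>2 / 4"
  have pos: "\<delta> > 0" "\<alpha> > 0" "\<eta> > 0" using \<epsilon> by (auto simp: \<delta>_def \<alpha>_def \<eta>_def D'_def)
  obtain b :: nat where b: "real b * (\<alpha> * \<delta>) \<ge> 2 * real D'"
    using ex_less_of_nat_mult[of "\<alpha> * \<delta>" "2 * real D'"] pos by (auto intro: less_imp_le)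
  have iter: "\<exists>m N. \<forall>V E. few_triangles (V :: 'a set) E D' \<longrightarrow> card V \<ge> N \<longrightarrow>
       real (card (few_triangles.triangles V E)) \<ge> \<epsilon> * (real (card V))\<^sup>2 \<longrightarrow>
       (\<exists>Z\<subseteq>V. card Z \<le> m \<and> few_triangles.energy V E Z \<ge> real j * \<eta> * (real (card V))\<^sup>2)" for j :: nat
  proof (induction j)
    case 0
    show ?case
      by (intro exI[of _ 0] allI impI exI[of _ "{}"]) (simp add: few_triangles.energy_nonneg)
  next
    case (Suc j)
    then obtain m N where IH: "\<And>(V :: 'a set) E. few_triangles V E D' \<Longrightarrow> card V \<ge> N \<Longrightarrow>
       real (card (few_triangles.triangles V E)) \<ge> \<epsilon> * (real (card V))\<^sup>2 \<Longrightarrow>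
       \<exists>Z\<subseteq>V. card Z \<le> m \<and> few_triangles.energy V E Z \<ge> real j * \<eta> * (real (card V))\<^sup>2"
      by blast
    \<comment> \<open>Up to \<open>2 ^ m\<close> cells may be smaller than \<open>b\<close>, so each
      step needs more vertices before their triangles become negligible.\<close>
    obtain N' :: nat where N': "real N' * \<epsilon> \<ge> 8 * real D' * real b * 2 ^ m"
      using ex_less_of_nat_mult[of "\<epsilon>"] \<epsilon> by (meson less_imp_le)
    show ?case
    proof (rule exI[of _ "m + 4 ^ m"], rule exI[of _ "max N N'"], intro allI impI)
      fix V :: "'a set" and E
      assume ft: "few_triangles V E D'" and N: "max N N' \<le> card V"
        and T: "\<epsilon> * (real (card V))\<^sup>2 \<le> real (card (few_triangles.triangles V E))"
      interpret few_triangles V E D' by (rule ft)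
      obtain Z where Z: "Z \<subseteq> V" "card Z \<le> m" "energy Z \<ge> real j * \<eta> * (real (card V))\<^sup>2"
        using IH[OF ft _ T] N by auto
      have "real N' * \<epsilon> \<le> real (card V) * \<epsilon>" using N \<epsilon> by (intro mult_right_mono) auto
      then have large: "\<epsilon> * real (card V) \<ge> 8 * real D' * real b * 2 ^ m"
        using N' by (simp add: mult.commute)
      from energy_step[OF \<epsilon> _ Z(1,2) T \<delta>_def \<alpha>_def b large]
      obtain Z' where Z': "Z' \<subseteq> V" "card Z' \<le> m + 4 ^ m" "energy Z' \<ge> energy Z + \<eta> * (real (card V))\<^sup>2"
        unfolding \<eta>_def D'_def by auto
      then show "\<exists>Z\<subseteq>V. card Z \<le> m + 4 ^ m \<and> real (Suc j) * \<eta> * (real (card V))\<^sup>2 \<le> energy Z"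
        using Z(3) by (intro exI[of _ Z']) (auto simp: algebra_simps)
    qed
  qed
  obtain j :: nat where j: "real j * \<eta> > 1"
    using ex_less_of_nat_mult[of \<eta> 1] pos by auto
  obtain m N where it: "\<And>(V :: 'a set) E. few_triangles V E D' \<Longrightarrow> card V \<ge> N \<Longrightarrow>
       real (card (few_triangles.triangles V E)) \<ge> \<epsilon> * (real (card V))\<^sup>2 \<Longrightarrow>
       \<exists>Z\<subseteq>V. card Z \<le> m \<and> few_triangles.energy V E Z \<ge> real j * \<eta> * (real (card V))\<^sup>2"
    using iter[of j] by blast
  show thesis
  proof (rule that[of "max N 1"])
    fix V :: "'a set" and E
    assume ft: "few_triangles V E D" and N: "max N 1 \<le> card V"
    have ft': "few_triangles V E D'"
      using ft unfolding few_triangles_def D'_def by (meson le_SucI)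
    interpret few_triangles V E D' by (rule ft')
    show "real (card triangles) \<le> \<epsilon> * (real (card V))\<^sup>2"
    proof (rule ccontr)
      assume "\<not> ?thesis"
      then obtain Z where "energy Z \<ge> real j * \<eta> * (real (card V))\<^sup>2"
        using it[OF ft'] N by force
      moreover have "real j * \<eta> * (real (card V))\<^sup>2 > 1 * (real (card V))\<^sup>2"
        using j N by (intro mult_strict_right_mono) auto
      ultimately show False using energy_le[of Z] by simp
    qed
  qed
qed

section \<open>A Mantel bound for few triangles per edge\<close>

text \<open>Mantel's argument: along an edge, \<open>deg x + deg y\<close> counts only the at most
  \<open>D\<close> common neighbours twice. Summed over edges, the left side becomes the sum of
  squared degrees, which Cauchy-Schwarz bounds from below. Pairs are ordered, so for loopless graphs
  this is \<open>card V * (card V + D) / 4\<close> edges.\<close>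

lemma (in few_triangles) card_edges_le:
  "2 * card {(x, y) \<in> V \<times> V. E x y} \<le> card V * (card V + D)"
proof -
  define deg where "deg x = card {y \<in> V. E x y}" for x
  define m where "m = card {(x, y) \<in> V \<times> V. E x y}"
  have edges: "{(x, y) \<in> V \<times> V. E x y} = (SIGMA x:V. {y \<in> V. E x y})" by auto
  have m: "m = (\<Sum>x\<in>V. deg x)"
    unfolding m_def edges deg_def using finite_V by simp
  have deg_pair: "deg x + deg y \<le> card V + D" if "x \<in> V" "y \<in> V" "E x y" for x y
  proof -
    have "deg x + deg y = card ({z \<in> V. E x z} \<union> {z \<in> V. E y z}) + card ({z \<in> V. E x z} \<inter> {z \<in> V. E y z})"
      unfolding deg_def using finite_V by (intro card_Un_Int) auto
    also have "{z \<in> V. E x z} \<inter> {z \<in> V. E y z} = {z \<in> V. E x z \<and> E y z}" by auto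
    also have "card ({z \<in> V. E x z} \<union> {z \<in> V. E y z}) \<le> card V"
      using finite_V by (intro card_mono) auto
    finally show ?thesis using codegree[OF that] by linarith
  qed
  have sum_deg: "(\<Sum>x\<in>V. \<Sum>y | y \<in> V \<and> E x y. deg x) = (\<Sum>x\<in>V. (deg x)\<^sup>2)"
    by (simp add: deg_def power2_eq_square)
  have "(\<Sum>x\<in>V. \<Sum>y | y \<in> V \<and> E x y. deg y) = (\<Sum>y\<in>V. \<Sum>x | x \<in> V \<and> E x y. deg y)"
    using finite_V by (rule sum.swap_restrict) (rule finite_V)
  also have "\<dots> = (\<Sum>y\<in>V. \<Sum>x | x \<in> V \<and> E y x. deg y)"
    by (intro sum.cong refl) (auto intro: sym)
  finally have sum_deg': "(\<Sum>x\<in>V. \<Sum>y | y \<in> V \<and> E x y. deg y) = (\<Sum>x\<in>V. (deg x)\<^sup>2)"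
    using sum_deg by simp
  have "2 * (\<Sum>x\<in>V. (deg x)\<^sup>2) = (\<Sum>x\<in>V. \<Sum>y | y \<in> V \<and> E x y. deg x + deg y)"
    using sum_deg sum_deg' by (simp add: sum.distrib)
  also have "\<dots> \<le> (\<Sum>x\<in>V. \<Sum>y | y \<in> V \<and> E x y. card V + D)"
    using deg_pair by (intro sum_mono) auto
  also have "\<dots> = m * (card V + D)"
    by (simp add: m deg_def sum_distrib_right)
  finally have upper: "2 * (\<Sum>x\<in>V. (deg x)\<^sup>2) \<le> m * (card V + D)" .
  have "(real m)\<^sup>2 \<le> real (card V) * (\<Sum>x\<in>V. (real (deg x))\<^sup>2)"
  proof (cases "V = {}")
    case False
    then have N: "real (card V) > 0" using finite_V by (simp add: card_gt_0_iff)
    \<comment> \<open>Cauchy-Schwarz in the form that the variance of the degrees is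
      nonnegative.\<close>
    have "0 \<le> (\<Sum>x\<in>V. (real (card V) * real (deg x) - real m)\<^sup>2)"
      by (intro sum_nonneg) auto
    also have "\<dots> = (\<Sum>x\<in>V. (real (card V))\<^sup>2 * (real (deg x))\<^sup>2 - 2 * real (card V) * real m * real (deg x) + (real m)\<^sup>2)"
      by (intro sum.cong refl) (simp add: power2_diff power_mult_distrib)
    also have "\<dots> = (real (card V))\<^sup>2 * (\<Sum>x\<in>V. (real (deg x))\<^sup>2)
        - 2 * real (card V) * real m * (\<Sum>x\<in>V. real (deg x)) + real (card V) * (real m)\<^sup>2"
      by (simp add: sum.distrib sum_subtractf sum_distrib_left)
    also have "(\<Sum>x\<in>V. real (deg x)) = real m" by (simp add: m)
    finally have "0 \<le> real (card V) * (real (card V) * (\<Sum>x\<in>V. (real (deg x))\<^sup>2) - (real m)\<^sup>2)"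
      by (simp add: power2_eq_square algebra_simps)
    then show ?thesis using N by (simp add: zero_le_mult_iff)
  qed (simp add: m)
  also have "\<dots> = real (card V * (\<Sum>x\<in>V. (deg x)\<^sup>2))" by simp
  finally have "m\<^sup>2 \<le> card V * (\<Sum>x\<in>V. (deg x)\<^sup>2)"
    unfolding of_nat_power[symmetric] of_nat_le_iff .
  then have "2 * m\<^sup>2 \<le> card V * (2 * (\<Sum>x\<in>V. (deg x)\<^sup>2))" by simp
  also have "\<dots> \<le> card V * (m * (card V + D))" using upper by (intro mult_left_mono) auto
  finally have "m * (2 * m) \<le> m * (card V * (card V + D))"
    by (simp add: power2_eq_square mult_ac)
  then show ?thesis unfolding m_def[symmetric] by (cases "m = 0") auto
qed

subsection \<open>Finding Berge books\<close>

lemma card_book_edges: "card (book_edges t) \<le> 2 * t + 1" and finite_book_edges: "finite (book_edges t)"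
proof -
  have "card (\<Union>i\<in>{1..t}. {{0, i+1}, {1, i+1 :: nat}}) \<le> (\<Sum>i\<in>{1..t}. card {{0, i+1}, {1, i+1}})"
    by (rule card_UN_le) simp
  also have "\<dots> \<le> (\<Sum>i\<in>{1..t}. 2)"
    by (intro sum_mono) (auto simp: card_insert_if)
  finally show "card (book_edges t) \<le> 2 * t + 1"
    unfolding book_edges_def
    using card_insert_le_m1[of "Suc (2 * t)" "\<Union>i\<in>{1..t}. {{0, i+1}, {1, i+1 :: nat}}" "{0, 1}"]
    by (simp add: card_insert_if)
qed (auto simp: book_edges_def)

lemma system_of_distinct_representatives:
  assumes "finite I" and "\<And>i. i \<in> I \<Longrightarrow> finite (S i) \<and> card (S i) \<ge> card I"
  shows "\<exists>f. inj_on f I \<and> (\<forall>i\<in>I. f i \<in> S i)"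
  using assms
proof (induction I rule: finite_induct)
  case (insert i I)
  then obtain f where f: "inj_on f I" "\<forall>j\<in>I. f j \<in> S j" by (force simp: Suc_le_eq)
  have "card (f ` I) < card (S i)"
    using insert.hyps insert.prems[of i] card_image_le[of I f] by auto
  then obtain s where "s \<in> S i" "s \<notin> f ` I"
    using card_mono[of "f ` I" "S i"] insert.hyps(1) by (meson finite_imageI leD subsetI)
  then show ?case
    using f insert.hyps by (intro exI[of _ "f(i := s)"]) (auto simp: inj_on_def image_iff)
qed auto

text \<open>The vertices of the book can be placed arbitrarily in \<open>X\<close>; its at most
  \<open>2 * t + 1\<close> edges then receive different hyperedges greedily.\<close>

lemma berge_book_of_heavy_clique:
  assumes "finite H" and "X \<subseteq> {..<n}" and "card X \<ge> t + 2"
    and heavy: "\<And>u v. u \<in> X \<Longrightarrow> v \<in> X \<Longrightarrow> u \<noteq> v \<Longrightarrow> card {e \<in> H. u \<in> e \<and> v \<in> e} \<ge> 2 * t + 1"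
  shows "berge_copy (book_vertices t) (book_edges t) n H"
proof -
  have "finite X" using assms(2) finite_subset by blast
  have "card (book_vertices t) \<le> card X" using assms(3) by (simp add: book_vertices_def)
  then obtain \<phi> where \<phi>: "inj_on \<phi> (book_vertices t)" "\<phi> ` book_vertices t \<subseteq> X"
    using card_le_inj[of "book_vertices t" X] \<open>finite X\<close> by (auto simp: book_vertices_def)
  obtain f where f: "inj_on f (book_edges t)" "\<forall>e\<in>book_edges t. f e \<in> {h \<in> H. \<phi> ` e \<subseteq> h}"
  proof (rule exE[OF system_of_distinct_representatives[OF finite_book_edges]])
    fix e assume "e \<in> book_edges t"
    then obtain i j where ij: "e = {i, j}" "i \<noteq> j" "i \<in> book_vertices t" "j \<in> book_vertices t"
      by (auto simp: book_edges_def book_vertices_def)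
    then have "\<phi> i \<noteq> \<phi> j" "\<phi> i \<in> X" "\<phi> j \<in> X" using \<phi> by (auto simp: inj_on_def)
    then have "2 * t + 1 \<le> card {h \<in> H. \<phi> i \<in> h \<and> \<phi> j \<in> h}" by (intro heavy)
    then show "finite {h \<in> H. \<phi> ` e \<subseteq> h} \<and> card (book_edges t) \<le> card {h \<in> H. \<phi> ` e \<subseteq> h}"
      using card_book_edges[of t] ij \<open>finite H\<close> by simp
  qed (use that in blast)
  have "\<phi> ` book_vertices t \<subseteq> {..<n}" using \<phi>(2) assms(2) by (rule order_trans)
  moreover have "f ` book_edges t \<subseteq> H" "\<forall>e\<in>book_edges t. \<phi> ` e \<subseteq> f e" using f(2) by simp_all blast
  ultimately show ?thesis
    unfolding berge_copy_def using \<phi>(1) f(1) by metis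
qed

text \<open>Interface for greedy constructions: \<open>g\<close>, \<open>a w\<close> and
  \<open>b w\<close> are the hyperedges standing for \<open>u v\<close>, \<open>u w\<close> and
  \<open>v w\<close>.\<close>

lemma berge_bookI:
  assumes "finite W" "card W = t" "u \<noteq> v" "u \<notin> W" "v \<notin> W" "{u, v} \<union> W \<subseteq> {..<n}"
    and "inj_on a W" "inj_on b W" "a ` W \<inter> b ` W = {}" "g \<notin> a ` W \<union> b ` W"
    and "insert g (a ` W \<union> b ` W) \<subseteq> H" "{u, v} \<subseteq> g"
    and ab: "\<And>w. w \<in> W \<Longrightarrow> {u, w} \<subseteq> a w \<and> {v, w} \<subseteq> b w"
  shows "berge_copy (book_vertices t) (book_edges t) n H"
proof -
  obtain h where h: "bij_betw h {1..t} W"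
    using ex_bij_betw_nat_finite_1[OF assms(1)] assms(2) by auto
  then have h_inj: "inj_on h {1..t}" and h_W: "\<And>i. i \<in> {1..t} \<Longrightarrow> h i \<in> W"
    by (auto simp: bij_betw_def)
  define \<phi> where "\<phi> i = (if i = 0 then u else if i = 1 then v else h (i - 1))" for i :: nat
  \<comment> \<open>In \<open>{0, j + 1}\<close> and \<open>{1, j + 1}\<close> the maximum
    identifies the page, and membership of 0 tells the two edges apart.\<close>
  define f where "f e = (if e = {0, 1} then g else if 0 \<in> e then a (\<phi> (Max e)) else b (\<phi> (Max e)))" for e :: "nat set"
  have vert: "i = 0 \<or> i = 1 \<or> (\<exists>j\<in>{1..t}. i = Suc j)" if "i \<in> book_vertices t" for i
    using that by (cases i) (auto simp: book_vertices_def)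
  have \<phi>_simps: "\<phi> 0 = u" "\<phi> 1 = v" "\<phi> (Suc 0) = v" "\<And>j. j \<ge> 1 \<Longrightarrow> \<phi> (Suc j) = h j"
    by (auto simp: \<phi>_def)
  have edge: "e = {0, 1} \<or> (\<exists>j\<in>{1..t}. e = {0, Suc j}) \<or> (\<exists>j\<in>{1..t}. e = {1, Suc j})"
    if "e \<in> book_edges t" for e
    using that by (auto simp: book_edges_def)
  have f_simps: "f {0, 1} = g" "\<And>j. j \<in> {1..t} \<Longrightarrow> f {0, Suc j} = a (h j)"
    "\<And>j. j \<in> {1..t} \<Longrightarrow> f {1, Suc j} = b (h j)"
    by (auto simp: f_def \<phi>_simps doubleton_eq_iff)
  show ?thesis
    unfolding berge_copy_def
  proof (intro exI conjI ballI)
    show "inj_on \<phi> (book_vertices t)"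
    proof (rule inj_onI)
      fix i j assume "i \<in> book_vertices t" "j \<in> book_vertices t" "\<phi> i = \<phi> j"
      then show "i = j"
        using vert[of i] vert[of j] assms(3-5) h_W inj_onD[OF h_inj] by (auto simp: \<phi>_simps)
    qed
    show "\<phi> ` book_vertices t \<subseteq> {..<n}"
    proof (rule image_subsetI)
      fix i assume "i \<in> book_vertices t"
      then consider "i = 0" | "i = 1" | j where "j \<in> {1..t}" "i = Suc j"
        using vert[of i] by blast
      then show "\<phi> i \<in> {..<n}"
      proof cases
        case 3
        then show ?thesis using h_W[of j] assms(6) by (auto simp: \<phi>_simps)
      qed (use assms(6) in \<open>auto simp: \<phi>_simps\<close>)
    qed
    have disj: "\<And>i j. i \<in> {1..t} \<Longrightarrow> j \<in> {1..t} \<Longrightarrow> a (h i) \<noteq> b (h j)"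
      "\<And>i. i \<in> {1..t} \<Longrightarrow> a (h i) \<noteq> g \<and> b (h i) \<noteq> g"
      using assms(9,10) h_W by (metis IntI empty_iff imageI, metis UnI1 UnI2 imageI)
    have inj: "i = j" if "i \<in> {1..t}" "j \<in> {1..t}" "a (h i) = a (h j) \<or> b (h i) = b (h j)" for i j
    proof -
      have "h i = h j"
        using that(3) inj_onD[OF assms(7) _ h_W[OF that(1)] h_W[OF that(2)]]
          inj_onD[OF assms(8) _ h_W[OF that(1)] h_W[OF that(2)]] by blast
      then show ?thesis using inj_onD[OF h_inj _ that(1,2)] by blast
    qed
    show "inj_on f (book_edges t)"
    proof (rule inj_onI)
      fix d e assume d: "d \<in> book_edges t" and e: "e \<in> book_edges t" and "f d = f e"
      from edge[OF d] edge[OF e] this(3) show "d = e"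
        by (elim disjE bexE; simp only: f_simps; metis disj inj)
    qed
    show "f ` book_edges t \<subseteq> H"
    proof (rule image_subsetI)
      fix e assume e: "e \<in> book_edges t"
      from edge[OF e] show "f e \<in> H"
        by (elim disjE bexE; simp only: f_simps) (use assms(11) h_W in blast)+
    qed
    fix e assume e: "e \<in> book_edges t"
    consider "e = {0, 1}" | j where "j \<in> {1..t}" "e = {0, Suc j}" | j where "j \<in> {1..t}" "e = {1, Suc j}"
      using edge[OF e] by blast
    then show "\<phi> ` e \<subseteq> f e"
    proof cases
      case 1
      then show ?thesis using f_simps(1) assms(12) \<phi>_simps by auto
    next
      case 2
      then show ?thesis using f_simps(2) ab[OF h_W] \<phi>_simps by auto
    next
      case 3
      then show ?thesis using f_simps(3) ab[OF h_W] \<phi>_simps by auto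
    qed
  qed
qed

subsection \<open>Codegrees in hypergraphs without a Berge book\<close>

locale berge_book_free =
  fixes r t n :: nat and H :: "nat set set"
  assumes H: "H \<in> uniform_hypergraphs r n"
    and free: "\<not> berge_copy (book_vertices t) (book_edges t) n H"
    and r: "r \<ge> 2"
begin

lemma edge: "e \<in> H \<Longrightarrow> e \<subseteq> {..<n}" "e \<in> H \<Longrightarrow> card e = r" "e \<in> H \<Longrightarrow> finite e"
  using H finite_subset[of e "{..<n}"] by (auto simp: uniform_hypergraphs_def)

lemma finite_H: "finite H"
  by (rule finite_subset[of _ "Pow {..<n}"]) (use edge in auto)

definition codeg :: "nat \<Rightarrow> nat \<Rightarrow> nat" where
  "codeg u v = card {e \<in> H. u \<in> e \<and> v \<in> e}"

text \<open>These \<open>w\<close> complete \<open>u v\<close> to a Berge triangle, up to a third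
  hyperedge for \<open>u v\<close> itself.\<close>

definition linked :: "nat \<Rightarrow> nat \<Rightarrow> nat set" where
  "linked u v = {w. w \<noteq> u \<and> w \<noteq> v \<and>
     (\<exists>a\<in>H. \<exists>b\<in>H. a \<noteq> b \<and> {u, w} \<subseteq> a \<and> {v, w} \<subseteq> b)}"

text \<open>An upper bound for the vertices covered by the \<open>2 * t + 1\<close> hyperedges of a
  Berge book, that is, for what a greedy choice of page vertices has to avoid.\<close>

definition D :: nat where
  "D = r * (2 * t + 1)"

lemma codeg_commute: "codeg u v = codeg v u"
  unfolding codeg_def by (rule arg_cong[of _ _ card]) auto

lemma codeg_pos: "e \<in> H \<Longrightarrow> u \<in> e \<Longrightarrow> v \<in> e \<Longrightarrow> codeg u v \<ge> 1"
  unfolding codeg_def using finite_H by (auto simp: Suc_le_eq card_gt_0_iff)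

lemma codeg_posD: "codeg u v \<ge> 1 \<Longrightarrow> \<exists>e\<in>H. u \<in> e \<and> v \<in> e"
  unfolding codeg_def by (auto simp: Suc_le_eq card_gt_0_iff)

lemma finite_linked: "finite (linked u v)"
  by (rule finite_subset[of _ "{..<n}"]) (use edge in \<open>auto simp: linked_def\<close>)

text \<open>With more than \<open>D\<close> linked vertices a Berge book grows on
  \<open>u v\<close>: the next \<open>w\<close> is taken outside \<open>g\<close> and all hyperedges
  used so far, so \<open>a w\<close> and \<open>b w\<close>, which contain \<open>w\<close>, are
  automatically new.\<close>

lemma card_linked_le:
  assumes uv: "u \<noteq> v" "codeg u v \<ge> 1"
  shows "card (linked u v) \<le> D"
proof (rule ccontr)
  assume big: "\<not> card (linked u v) \<le> D"
  obtain g where g: "g \<in> H" "u \<in> g" "v \<in> g" using codeg_posD uv by blast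
  have "\<forall>w\<in>linked u v. \<exists>a b. a \<in> H \<and> b \<in> H \<and> a \<noteq> b \<and> {u, w} \<subseteq> a \<and> {v, w} \<subseteq> b"
    unfolding linked_def by blast
  then obtain a b where ab: "\<And>w. w \<in> linked u v \<Longrightarrow>
      a w \<in> H \<and> b w \<in> H \<and> a w \<noteq> b w \<and> {u, w} \<subseteq> a w \<and> {v, w} \<subseteq> b w"
    by metis
  have "\<exists>W. finite W \<and> W \<subseteq> linked u v \<and> card W = j \<and> inj_on a W \<and> inj_on b W \<and>
      a ` W \<inter> b ` W = {} \<and> g \<notin> a ` W \<union> b ` W" if "j \<le> t" for j
    using that
  proof (induction j)
    case 0
    show ?case by (intro exI[of _ "{}"]) auto
  next
    case (Suc j)
    then obtain W where W: "finite W" "W \<subseteq> linked u v" "card W = j" "inj_on a W" "inj_on b W"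
      "a ` W \<inter> b ` W = {}" "g \<notin> a ` W \<union> b ` W" by auto
    define S where "S = g \<union> (\<Union>w\<in>W. a w \<union> b w)"
    have "card (a w \<union> b w) \<le> 2 * r" if "w \<in> W" for w
      using card_Un_le[of "a w" "b w"] ab[of w] edge W(2) that by (metis mult_2 subsetD)
    then have "card (\<Union>w\<in>W. a w \<union> b w) \<le> card W * (2 * r)"
      using card_UN_le[OF W(1), of "\<lambda>w. a w \<union> b w"] sum_bounded_above[of W "\<lambda>w. card (a w \<union> b w)" "2 * r"]
      by simp
    then have "card S \<le> r + j * (2 * r)"
      using card_Un_le[of g "\<Union>w\<in>W. a w \<union> b w"] edge(2)[OF g(1)] W(3) by (simp add: S_def)
    also have "\<dots> \<le> D"
      using mult_le_mono1[of j t "2 * r"] Suc.prems by (simp add: D_def algebra_simps)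
    finally have "card S < card (linked u v)" using big by simp
    moreover have "finite S"
      using edge(3) g(1) W(1,2) ab by (auto simp: S_def)
    ultimately obtain w where w: "w \<in> linked u v" "w \<notin> S"
      using card_mono[of S "linked u v"] by (meson leD subsetI)
    have "a w \<noteq> g" "b w \<noteq> g" "a w \<noteq> b w" "w \<notin> W"
      using ab[OF w(1)] ab W(2) w(2) by (auto simp: S_def)
    moreover have "a w \<notin> a ` W \<union> b ` W" "b w \<notin> a ` W \<union> b ` W"
      using ab[OF w(1)] w(2) by (auto simp: S_def)
    ultimately show ?case
      using W w(1) by (intro exI[of _ "insert w W"]) (simp add: inj_on_insert disjoint_iff)
  qed
  from this[of t] obtain W where W: "finite W" "W \<subseteq> linked u v" "card W = t" "inj_on a W" "inj_on b W"
      "a ` W \<inter> b ` W = {}" "g \<notin> a ` W \<union> b ` W" by auto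
  have "berge_copy (book_vertices t) (book_edges t) n H"
  proof (rule berge_bookI[where W = W and u = u and v = v and a = a and b = b and g = g])
    show "u \<notin> W" "v \<notin> W" using W(2) by (auto simp: linked_def)
    show "{u, v} \<union> W \<subseteq> {..<n}"
      using g edge(1)[OF g(1)] W(2) ab edge(1) by blast
    show "insert g (a ` W \<union> b ` W) \<subseteq> H" using g(1) ab W(2) by blast
    show "{u, w} \<subseteq> a w \<and> {v, w} \<subseteq> b w" if "w \<in> W" for w using ab W(2) that by blast
  qed (use W uv g in auto)
  then show False using free by simp
qed

lemma codeg_ge2D:
  assumes "codeg u v \<ge> 2"
  shows "\<exists>f\<in>H. f \<noteq> e \<and> u \<in> f \<and> v \<in> f"
proof (rule ccontr)
  assume "\<not> ?thesis"
  then have "{e \<in> H. u \<in> e \<and> v \<in> e} \<subseteq> {e}" by auto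
  then have "codeg u v \<le> card {e}" unfolding codeg_def by (intro card_mono) auto
  then show False using assms by simp
qed

lemma linkedI:
  assumes "e \<in> H" "u \<in> e" "v \<in> e" "w \<in> e" "w \<noteq> u" "w \<noteq> v"
    and "codeg u w \<ge> 2 \<or> codeg v w \<ge> 2"
  shows "w \<in> linked u v"
  using assms codeg_ge2D[of u w e] codeg_ge2D[of v w e] unfolding linked_def by blast

text \<open>Double counting with ordered pairs including the diagonal, hence the factor
  \<open>r^2\<close>.\<close>

lemma sum_codeg: "(\<Sum>(u, v)\<in>{..<n} \<times> {..<n}. codeg u v) = r\<^sup>2 * card H"
proof -
  have "(\<Sum>(u, v)\<in>{..<n} \<times> {..<n}. codeg u v)
      = (\<Sum>p\<in>{..<n} \<times> {..<n}. \<Sum>e\<in>H. of_bool (fst p \<in> e \<and> snd p \<in> e))"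
    using finite_H by (intro sum.cong refl) (auto simp: codeg_def Int_def)
  also have "\<dots> = (\<Sum>e\<in>H. \<Sum>p\<in>{..<n} \<times> {..<n}. of_bool (fst p \<in> e \<and> snd p \<in> e))"
    by (rule sum.swap)
  also have "\<dots> = (\<Sum>e\<in>H. r\<^sup>2)"
  proof (rule sum.cong[OF refl])
    fix e assume e: "e \<in> H"
    have "(\<Sum>p\<in>{..<n} \<times> {..<n}. of_bool (fst p \<in> e \<and> snd p \<in> e))
        = card (({..<n} \<times> {..<n}) \<inter> {p. fst p \<in> e \<and> snd p \<in> e})"
      by simp
    also have "({..<n} \<times> {..<n}) \<inter> {p. fst p \<in> e \<and> snd p \<in> e} = e \<times> e"
      using edge(1)[OF e] by auto
    also have "card (e \<times> e) = r\<^sup>2"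
      using edge(2)[OF e] by (simp add: card_cartesian_product power2_eq_square)
    finally show "(\<Sum>p\<in>{..<n} \<times> {..<n}. of_bool (fst p \<in> e \<and> snd p \<in> e)) = r\<^sup>2" .
  qed
  finally show ?thesis by (simp add: mult.commute)
qed

lemma card_heavy_pairs: "L * card {(u, v) \<in> {..<n} \<times> {..<n}. codeg u v \<ge> L} \<le> r\<^sup>2 * card H"
proof -
  have "L * card {(u, v) \<in> {..<n} \<times> {..<n}. codeg u v \<ge> L}
      = (\<Sum>p\<in>{(u, v) \<in> {..<n} \<times> {..<n}. codeg u v \<ge> L}. L)" by simp
  also have "\<dots> \<le> (\<Sum>(u, v)\<in>{(u, v) \<in> {..<n} \<times> {..<n}. codeg u v \<ge> L}. codeg u v)"
    by (intro sum_mono) auto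
  also have "\<dots> \<le> (\<Sum>(u, v)\<in>{..<n} \<times> {..<n}. codeg u v)"
    by (intro sum_mono2) auto
  finally show ?thesis by (simp add: sum_codeg)
qed

lemma ex_pair:
  assumes "e \<in> H"
  shows "\<exists>u v. u \<in> e \<and> v \<in> e \<and> u \<noteq> v"
proof -
  have "card e \<ge> 2" using edge(2)[OF assms] r by simp
  then obtain S where "S \<subseteq> e" "card S = 2" using obtain_subset_with_card_n by metis
  then show ?thesis by (auto simp: card_2_iff)
qed

section \<open>Exceptional edges and the crude bound on their number\<close>

definition all_heavy :: "nat \<Rightarrow> nat set set" where
  "all_heavy L = {e \<in> H. \<forall>u\<in>e. \<forall>v\<in>e. u \<noteq> v \<longrightarrow> codeg u v \<ge> L}"

text \<open>Fix one pair in each edge. Since all pairs have codegree at least 2, every other vertex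
  of the edge is linked to the fixed pair, so the edge is determined by a subset of a set of at most
  \<open>D\<close> vertices.\<close>

lemma card_all_heavy:
  assumes L: "L \<ge> 2"
  shows "card (all_heavy L) \<le> 2 ^ D * card {(u, v) \<in> {..<n} \<times> {..<n}. codeg u v \<ge> L}"
proof -
  obtain p1 p2 where p: "\<And>e. e \<in> H \<Longrightarrow> p1 e \<in> e \<and> p2 e \<in> e \<and> p1 e \<noteq> p2 e"
    using ex_pair by metis
  show ?thesis
  proof (rule card_le_fibres[where \<pi> = "\<lambda>e. (p1 e, p2 e)"])
    show "finite {(u, v) \<in> {..<n} \<times> {..<n}. codeg u v \<ge> L}"
      by (rule finite_subset[of _ "{..<n} \<times> {..<n}"]) auto
    show "finite (all_heavy L)" using finite_H by (simp add: all_heavy_def)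
    show "(p1 e, p2 e) \<in> {(u, v) \<in> {..<n} \<times> {..<n}. codeg u v \<ge> L}" if "e \<in> all_heavy L" for e
      using that p[of e] edge(1)[of e] by (auto simp: all_heavy_def)
    fix q assume "q \<in> {(u, v) \<in> {..<n} \<times> {..<n}. codeg u v \<ge> L}"
    then obtain u v where q: "q = (u, v)" "codeg u v \<ge> L" by auto
    let ?F = "{e \<in> all_heavy L. (p1 e, p2 e) = q}"
    show "card ?F \<le> 2 ^ D"
    proof (cases "u = v")
      case True
      then have "?F = {}" using p q by (fastforce simp: all_heavy_def)
      then show ?thesis by (simp only: card.empty)
    next
      case False
      have F: "e \<in> all_heavy L \<and> e \<in> H \<and> u \<in> e \<and> v \<in> e" if "e \<in> ?F" for e
        using that p[of e] q by (auto simp: all_heavy_def)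
      have "inj_on (\<lambda>e. e - {u, v}) ?F"
      proof (rule inj_onI)
        fix e f assume "e \<in> ?F" "f \<in> ?F" "e - {u, v} = f - {u, v}"
        then show "e = f" using F[of e] F[of f] by blast
      qed
      moreover have "(\<lambda>e. e - {u, v}) ` ?F \<subseteq> Pow (linked u v)"
      proof (rule image_subsetI, rule PowI, rule subsetI)
        fix e w assume "e \<in> ?F" and w: "w \<in> e - {u, v}"
        note e = F[OF this(1)]
        have "\<forall>x\<in>e. \<forall>y\<in>e. x \<noteq> y \<longrightarrow> L \<le> codeg x y"
          using e by (simp add: all_heavy_def)
        then have "codeg u w \<ge> L" using w e by simp
        then show "w \<in> linked u v" using linkedI[of e u v w] e w L by auto
      qed
      ultimately have "card ?F \<le> card (Pow (linked u v))"
        using finite_linked by (intro card_inj_on_le) auto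
      also have "\<dots> \<le> 2 ^ D"
        using card_linked_le[OF False] q L finite_linked by (simp add: card_Pow)
      finally show ?thesis .
    qed
  qed
qed

text \<open>An edge containing a pair of codegree 1 is determined by that pair; all other edges lie
  in \<open>all_heavy 2\<close>. This turns bounds relative to \<open>card H\<close> into bounds
  relative to \<open>n^2\<close>.\<close>

lemma card_H_le: "card H \<le> (1 + 2 ^ D) * n\<^sup>2"
proof -
  define H1 where "H1 = H - all_heavy 2"
  have "\<forall>e\<in>H1. \<exists>u v. u \<in> e \<and> v \<in> e \<and> codeg u v < 2"
    by (auto simp: H1_def all_heavy_def not_less)
  then obtain p1 p2 where p: "\<And>e. e \<in> H1 \<Longrightarrow> p1 e \<in> e \<and> p2 e \<in> e \<and> codeg (p1 e) (p2 e) < 2"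
    by metis
  have "card H1 \<le> 1 * card ({..<n} \<times> {..<n})"
  proof (rule card_le_fibres[where \<pi> = "\<lambda>e. (p1 e, p2 e)"])
    show "(p1 e, p2 e) \<in> {..<n} \<times> {..<n}" if "e \<in> H1" for e
      using that p[of e] edge(1)[of e] by (auto simp: H1_def)
    fix q
    show "card {e \<in> H1. (p1 e, p2 e) = q} \<le> 1" (is "card ?F \<le> 1")
    proof (cases "?F = {}")
      case False
      then obtain e where e: "e \<in> H1" "(p1 e, p2 e) = q" by auto
      have "?F \<subseteq> {f \<in> H. p1 e \<in> f \<and> p2 e \<in> f}"
      proof
        fix f assume "f \<in> ?F"
        then have f: "f \<in> H1" "p1 f = p1 e" "p2 f = p2 e" using e by auto
        then show "f \<in> {f \<in> H. p1 e \<in> f \<and> p2 e \<in> f}" using p[OF f(1)] by (auto simp: H1_def)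
      qed
      then have "card ?F \<le> codeg (p1 e) (p2 e)"
        unfolding codeg_def using finite_H by (intro card_mono) auto
      then show ?thesis using p[OF e(1)] by simp
    qed (simp only: card.empty)
  qed (use finite_H in \<open>auto simp: H1_def\<close>)
  moreover have "card (all_heavy 2) \<le> 2 ^ D * n\<^sup>2"
  proof -
    have "card {(u, v) \<in> {..<n} \<times> {..<n}. codeg u v \<ge> 2} \<le> card ({..<n} \<times> {..<n})"
      by (intro card_mono) auto
    then have "2 ^ D * card {(u, v) \<in> {..<n} \<times> {..<n}. codeg u v \<ge> 2} \<le> 2 ^ D * n\<^sup>2"
      by (simp add: card_cartesian_product power2_eq_square)
    then show ?thesis using card_all_heavy[of 2] by linarith
  qed
  moreover have "card H \<le> card H1 + card (all_heavy 2)"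
  proof -
    have "H \<subseteq> H1 \<union> all_heavy 2" by (auto simp: H1_def)
    then have "card H \<le> card (H1 \<union> all_heavy 2)"
      using finite_H by (intro card_mono) (auto simp: H1_def all_heavy_def)
    then show ?thesis using card_Un_le[of H1 "all_heavy 2"] by linarith
  qed
  ultimately show ?thesis by (simp add: card_cartesian_product power2_eq_square)
qed

text \<open>Comparing codegrees by their ratio, instead of by a fixed threshold, makes the count of
  these edges linear in \<open>1 / M\<close>.\<close>

definition unbalanced :: "nat \<Rightarrow> nat set set" where
  "unbalanced M = {e \<in> H. \<exists>u\<in>e. \<exists>x\<in>e. \<exists>v\<in>e. u \<noteq> x \<and>
     codeg u x \<ge> M * codeg u v \<and> v \<in> linked u x}"

text \<open>Charge \<open>e\<close> to the pair \<open>u v\<close>, which lies in only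
  \<open>codeg u v\<close> edges, at most \<open>codeg u x / M\<close>. For given \<open>u x\<close>
  there are at most \<open>D\<close> linked \<open>v\<close>, and the codegrees of all pairs
  \<open>u x\<close> sum to at most \<open>r^2 * card H\<close>.\<close>

lemma card_unbalanced: "M * card (unbalanced M) \<le> D * r\<^sup>2 * card H"
proof -
  define P where "P = {(u, x) \<in> {..<n} \<times> {..<n}. u \<noteq> x \<and> codeg u x \<ge> 1}"
  define Q where "Q p = {v \<in> linked (fst p) (snd p). M * codeg (fst p) v \<le> codeg (fst p) (snd p)}" for p
  have fP: "finite P" by (rule finite_subset[of _ "{..<n} \<times> {..<n}"]) (auto simp: P_def)
  have fQ: "finite (Q p)" for p using finite_linked by (simp add: Q_def)
  have "unbalanced M \<subseteq> (\<Union>p\<in>P. \<Union>v\<in>Q p. {e \<in> H. fst p \<in> e \<and> v \<in> e})"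
  proof
    fix e assume "e \<in> unbalanced M"
    then obtain u x v where e: "e \<in> H" "u \<in> e" "x \<in> e" "v \<in> e" "u \<noteq> x"
      "codeg u x \<ge> M * codeg u v" "v \<in> linked u x" by (auto simp: unbalanced_def)
    then have "(u, x) \<in> P" "v \<in> Q (u, x)" using edge(1) codeg_pos by (auto simp: P_def Q_def)
    then show "e \<in> (\<Union>p\<in>P. \<Union>v\<in>Q p. {e \<in> H. fst p \<in> e \<and> v \<in> e})" using e by force
  qed
  then have "card (unbalanced M) \<le> card (\<Union>p\<in>P. \<Union>v\<in>Q p. {e \<in> H. fst p \<in> e \<and> v \<in> e})"
    using fP fQ finite_H by (intro card_mono) auto
  also have "\<dots> \<le> (\<Sum>p\<in>P. card (\<Union>v\<in>Q p. {e \<in> H. fst p \<in> e \<and> v \<in> e}))"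
    by (rule card_UN_le[OF fP])
  also have "\<dots> \<le> (\<Sum>p\<in>P. \<Sum>v\<in>Q p. codeg (fst p) v)"
    unfolding codeg_def by (intro sum_mono card_UN_le fQ)
  finally have "M * card (unbalanced M) \<le> (\<Sum>p\<in>P. \<Sum>v\<in>Q p. M * codeg (fst p) v)"
    by (simp add: sum_distrib_left[symmetric])
  also have "\<dots> \<le> (\<Sum>p\<in>P. D * codeg (fst p) (snd p))"
  proof (rule sum_mono)
    fix p assume p: "p \<in> P"
    have "(\<Sum>v\<in>Q p. M * codeg (fst p) v) \<le> card (Q p) * codeg (fst p) (snd p)"
      using sum_bounded_above[of "Q p" "\<lambda>v. M * codeg (fst p) v" "codeg (fst p) (snd p)"]
      by (simp add: Q_def)
    also have "card (Q p) \<le> card (linked (fst p) (snd p))"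
      using finite_linked by (intro card_mono) (auto simp: Q_def)
    also have "\<dots> \<le> D" using p by (intro card_linked_le) (auto simp: P_def)
    finally show "(\<Sum>v\<in>Q p. M * codeg (fst p) v) \<le> D * codeg (fst p) (snd p)" by simp
  qed
  also have "\<dots> \<le> (\<Sum>p\<in>{..<n} \<times> {..<n}. D * codeg (fst p) (snd p))"
    by (intro sum_mono2) (auto simp: P_def)
  also have "\<dots> = D * (r\<^sup>2 * card H)"
    by (simp add: sum_codeg[symmetric] sum_distrib_left split_beta)
  finally show ?thesis by (simp add: mult.assoc)
qed

text \<open>For \<open>C = 2\<close> these are the pairs of codegree exactly 1, which carry the main
  term; a large \<open>C\<close> is used to exclude triangles.\<close>

definition light :: "nat \<Rightarrow> nat \<Rightarrow> nat \<Rightarrow> bool" where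
  "light C u v \<longleftrightarrow> u \<noteq> v \<and> 1 \<le> codeg u v \<and> codeg u v < C"

text \<open>A common neighbour reached through two different edges is linked to \<open>u v\<close>.
  Otherwise it shares an edge with both \<open>u\<close> and \<open>v\<close>, and fewer than
  \<open>C\<close> edges of size \<open>r\<close> contain that pair.\<close>

lemma few_triangles_light: "few_triangles {..<n} (light C) (D + C * r)"
proof
  show "light C y x" if "light C x y" for x y
    using that codeg_commute by (auto simp: light_def)
  fix u v assume uv: "light C u v"
  let ?E = "{e \<in> H. u \<in> e \<and> v \<in> e}"
  have "{z \<in> {..<n}. light C u z \<and> light C v z} \<subseteq> linked u v \<union> \<Union>?E"
  proof
    fix z assume "z \<in> {z \<in> {..<n}. light C u z \<and> light C v z}"
    then have z: "z \<noteq> u" "z \<noteq> v" "codeg u z \<ge> 1" "codeg v z \<ge> 1" by (auto simp: light_def)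
    then obtain a b where "a \<in> H" "b \<in> H" "{u, z} \<subseteq> a" "{v, z} \<subseteq> b" using codeg_posD by blast
    then show "z \<in> linked u v \<union> \<Union>?E"
      using z by (cases "a = b") (auto simp: linked_def)
  qed
  then have "card {z \<in> {..<n}. light C u z \<and> light C v z} \<le> card (linked u v \<union> \<Union>?E)"
    using finite_linked finite_H edge(3) by (intro card_mono) auto
  also have "\<dots> \<le> card (linked u v) + card (\<Union>?E)" by (rule card_Un_le)
  also have "card (\<Union>?E) \<le> sum card ?E" by (rule card_Union_le_sum_card)
  also have "\<dots> \<le> card ?E * r"
    using sum_bounded_above[of ?E card r] edge(2) by simp
  also have "\<dots> \<le> C * r" using uv by (simp add: light_def codeg_def)
  also have "card (linked u v) \<le> D" using uv by (intro card_linked_le) (auto simp: light_def)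
  finally show "card {z \<in> {..<n}. light C u z \<and> light C v z} \<le> D + C * r" by simp
qed simp

definition light_triangle_edges :: "nat \<Rightarrow> nat set set" where
  "light_triangle_edges C = {e \<in> H. \<exists>x\<in>e. \<exists>y\<in>e. \<exists>z\<in>e. light C x y \<and> light C x z \<and> light C y z}"

lemma card_light_triangle_edges:
  "card (light_triangle_edges C) \<le> C * card (few_triangles.triangles {..<n} (light C))"
proof -
  interpret few_triangles "{..<n}" "light C" "D + C * r" by (rule few_triangles_light)
  have "\<forall>e\<in>light_triangle_edges C. \<exists>x y z. x \<in> e \<and> y \<in> e \<and> z \<in> e \<and> light C x y \<and> light C x z \<and> light C y z"
    by (auto simp: light_triangle_edges_def)
  then obtain x y z where p: "\<And>e. e \<in> light_triangle_edges C \<Longrightarrow> x e \<in> e \<and> y e \<in> e \<and> z e \<in> e \<and>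
      light C (x e) (y e) \<and> light C (x e) (z e) \<and> light C (y e) (z e)" by metis
  show ?thesis
  proof (rule card_le_fibres[where \<pi> = "\<lambda>e. (x e, y e, z e)"])
    show "(x e, y e, z e) \<in> triangles" if "e \<in> light_triangle_edges C" for e
      using p[OF that] edge(1)[of e] that by (auto simp: triangles_def light_triangle_edges_def)
    fix q
    show "card {e \<in> light_triangle_edges C. (x e, y e, z e) = q} \<le> C" (is "card ?F \<le> C")
    proof (cases "?F = {}")
      case False
      then obtain e where e: "e \<in> light_triangle_edges C" "(x e, y e, z e) = q" by auto
      have "?F \<subseteq> {f \<in> H. x e \<in> f \<and> y e \<in> f}"
      proof
        fix f assume "f \<in> ?F"
        then have f: "f \<in> light_triangle_edges C" "x f = x e" "y f = y e" using e by auto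
        then have "f \<in> H" by (simp add: light_triangle_edges_def)
        then show "f \<in> {f \<in> H. x e \<in> f \<and> y e \<in> f}" using p[OF f(1)] f by simp
      qed
      then have "card ?F \<le> codeg (x e) (y e)"
        unfolding codeg_def using finite_H by (intro card_mono) auto
      then show ?thesis using p[OF e(1)] by (simp add: light_def)
    qed (simp only: card.empty le0)
  qed (use finite_H finite_triangles in \<open>auto simp: light_triangle_edges_def\<close>)
qed

section \<open>Structure and number of the remaining edges\<close>

text \<open>Two facts drive the proof: no three vertices of \<open>e\<close> have all codegrees
  below \<open>M * L\<close>, and if \<open>v\<close> is linked to \<open>u x\<close> inside
  \<open>e\<close>, then \<open>codeg u x\<close> is less than \<open>M * codeg u v\<close>.\<close>

lemma balanced_edge_structure:
  assumes e: "e \<in> H" and unb: "e \<notin> unbalanced M" and heavy: "e \<notin> all_heavy L"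
    and tri: "e \<notin> light_triangle_edges (M * L)"
    and M: "M \<ge> 1" and L: "L \<ge> 2 * t + 1" and t: "t \<ge> 1"
  shows "\<exists>X Y. X \<union> Y = e \<and> X \<inter> Y = {} \<and> X \<noteq> {} \<and> Y \<noteq> {} \<and> card X \<le> t + 1 \<and> card Y \<le> t + 1 \<and>
    (\<forall>x\<in>X. \<forall>y\<in>Y. codeg x y = 1)"
proof -
  have MLge: "M * L \<ge> M" "M * L \<ge> L" using M L by auto
  have pos: "codeg u v \<ge> 1" if "u \<in> e" "v \<in> e" for u v using codeg_pos[OF e] that .
  have unb': "v \<notin> linked u x" if "u \<in> e" "x \<in> e" "v \<in> e" "u \<noteq> x" "codeg u x \<ge> M * codeg u v" for u v x
    using unb e that unfolding unbalanced_def by blast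
  have tri': "codeg x y \<ge> M * L \<or> codeg x z \<ge> M * L \<or> codeg y z \<ge> M * L"
    if "x \<in> e" "y \<in> e" "z \<in> e" "x \<noteq> y" "x \<noteq> z" "y \<noteq> z" for x y z
  proof (rule ccontr)
    assume "\<not> ?thesis"
    then have "light (M * L) x y \<and> light (M * L) x z \<and> light (M * L) y z"
      using pos that by (simp add: light_def)
    then show False using tri e that unfolding light_triangle_edges_def by blast
  qed
  \<comment> \<open>A second edge through \<open>x v\<close> makes \<open>v\<close> linked to
    \<open>u x\<close>, and balance is applied with \<open>codeg u v = 1\<close>.\<close>
  have lt_M: "codeg u x < M"
    if "u \<in> e" "x \<in> e" "v \<in> e" "u \<noteq> x" "v \<noteq> u" "v \<noteq> x" "codeg x v \<ge> 2" "codeg u v = 1" for u x v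
  proof (rule ccontr)
    assume "\<not> codeg u x < M"
    then have "v \<notin> linked u x" using unb'[of u x v] that by simp
    then show False using linkedI[of e u x v] e that by simp
  qed
  \<comment> \<open>If transitivity failed, the codegrees would be 1, below \<open>M\<close> and
    below \<open>M\<close>: a light triangle.\<close>
  have trans: "codeg u v \<ge> 2"
    if d: "u \<in> e" "x \<in> e" "v \<in> e" "u \<noteq> x" "v \<noteq> u" "v \<noteq> x" and c: "codeg u x \<ge> 2" "codeg x v \<ge> 2" for u x v
  proof (rule ccontr)
    assume "\<not> ?thesis"
    then have one: "codeg u v = 1" "codeg v u = 1" using pos[of u v] d codeg_commute[of u v] by auto
    have "codeg u x < M" using lt_M[of u x v] d c one by blast
    moreover have "codeg v x < M" using lt_M[of v x u] d c one codeg_commute[of u x] by force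
    ultimately show False using tri'[of u x v] d one MLge L t codeg_commute[of v x] by force
  qed
  \<comment> \<open>A third vertex \<open>w\<close> is what lifts 2 to \<open>L\<close>: if
    \<open>u v\<close> had codegree below \<open>L\<close>, then \<open>u w\<close> or
    \<open>v w\<close> would reach \<open>M * L\<close>, too much against
    \<open>M * codeg u v\<close> for a balanced edge.\<close>
  have all_L: "codeg u v \<ge> L"
    if S: "S \<subseteq> e" "\<And>u v. u \<in> S \<Longrightarrow> v \<in> S \<Longrightarrow> u \<noteq> v \<Longrightarrow> codeg u v \<ge> 2" "card S \<ge> 3"
      and uv: "u \<in> S" "v \<in> S" "u \<noteq> v" for S u v
  proof (rule ccontr)
    assume "\<not> ?thesis"
    then have lt: "codeg u v < L" by simp
    have "codeg u v < M * L" using lt MLge(2) by (rule less_le_trans)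
    with lt have small: "M * codeg u v \<le> M * L" "\<not> codeg u v \<ge> M * L" by auto
    have "card (S - {u, v}) \<ge> 1"
      using S(3) uv by (subst card_Diff_subset) auto
    then obtain w where w: "w \<in> S" "w \<noteq> u" "w \<noteq> v"
      using card_eq_0_iff[of "S - {u, v}"] by (metis Diff_iff all_not_in_conv insertCI not_one_le_zero)
    have in_e: "u \<in> e" "v \<in> e" "w \<in> e" using S(1) uv w by auto
    have ge2: "codeg w v \<ge> 2" "codeg w u \<ge> 2" "codeg v w \<ge> 2" using S(2) uv w by auto
    have "codeg u w \<ge> M * L \<or> codeg v w \<ge> M * L"
      using tri'[of u v w] in_e uv w small by blast
    then show False
    proof
      assume "codeg u w \<ge> M * L"
      with small(1) have "M * codeg u v \<le> codeg u w" by (rule order_trans)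
      then have "v \<notin> linked u w" using unb'[of u w v] in_e w by auto
      moreover have "v \<in> linked u w" using linkedI[of e u w v] e in_e uv w ge2 by auto
      ultimately show False by simp
    next
      assume "codeg v w \<ge> M * L"
      with small(1) have "M * codeg v u \<le> codeg v w"
        unfolding codeg_commute[of u v] by (rule order_trans)
      then have "u \<notin> linked v w" using unb'[of v w u] in_e w by auto
      moreover have "u \<in> linked v w" using linkedI[of e v w u] e in_e uv w ge2 by auto
      ultimately show False by simp
    qed
  qed
  have size: "card S \<le> t + 1"
    if S: "S \<subseteq> e" "\<And>u v. u \<in> S \<Longrightarrow> v \<in> S \<Longrightarrow> u \<noteq> v \<Longrightarrow> codeg u v \<ge> 2" for S
  proof (rule ccontr)
    assume "\<not> ?thesis"
    then have big: "card S \<ge> t + 2" by simp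
    have "berge_copy (book_vertices t) (book_edges t) n H"
    proof (rule berge_book_of_heavy_clique[OF finite_H _ big])
      show "S \<subseteq> {..<n}" using S(1) edge(1)[OF e] by simp
      fix u v assume uv: "u \<in> S" "v \<in> S" "u \<noteq> v"
      have "codeg u v \<ge> L" using all_L[OF S _ uv] big t by simp
      then show "2 * t + 1 \<le> card {e \<in> H. u \<in> e \<and> v \<in> e}" using L by (simp add: codeg_def)
    qed
    then show False using free by simp
  qed
  obtain u0 where u0: "u0 \<in> e" using ex_pair[OF e] by blast
  define X where "X = {v \<in> e. v = u0 \<or> codeg u0 v \<ge> 2}"
  define Y where "Y = e - X"
  have cross: "codeg x y = 1" if "x \<in> X" "y \<in> Y" for x y
  proof (rule ccontr)
    assume "\<not> ?thesis"
    then have "codeg x y \<ge> 2" using pos[of x y] that by (auto simp: X_def Y_def)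
    then have "codeg u0 y \<ge> 2" using trans[of u0 x y] that u0 by (cases "x = u0") (auto simp: X_def Y_def)
    then show False using that by (auto simp: X_def Y_def)
  qed
  have X2: "codeg u v \<ge> 2" if "u \<in> X" "v \<in> X" "u \<noteq> v" for u v
    using trans[of u u0 v] that u0 codeg_commute[of u u0] by (cases "u = u0"; cases "v = u0") (auto simp: X_def)
  \<comment> \<open>Why there is no third class: both vertices have codegree 1 with
    \<open>u0\<close>, so only a large codegree between them avoids a light triangle.\<close>
  have Y2: "codeg u v \<ge> 2" if uv: "u \<in> Y" "v \<in> Y" "u \<noteq> v" for u v
  proof -
    have "u0 \<in> X" using u0 by (simp add: X_def)
    then have "codeg u0 u = 1" "codeg u0 v = 1" using cross uv by auto
    moreover have "u \<in> e" "v \<in> e" "u0 \<noteq> u" "u0 \<noteq> v" using uv u0 by (auto simp: X_def Y_def)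
    ultimately have "codeg u v \<ge> M * L" using tri'[of u0 u v] u0 uv(3) MLge L t by force
    then show ?thesis using MLge L t by linarith
  qed
  have "Y \<noteq> {}"
  proof
    assume "Y = {}"
    then have Xe: "X = e" by (auto simp: X_def Y_def)
    show False
    \<comment> \<open>\<open>all_L\<close> needs three vertices. For \<open>r = 2\<close> an edge is
      its own only pair, which therefore has codegree 1.\<close>
    proof (cases "r = 2")
      case True
      obtain u v where uv: "u \<in> e" "v \<in> e" "u \<noteq> v" using ex_pair[OF e] by blast
      obtain f where f: "f \<in> H" "f \<noteq> e" "u \<in> f" "v \<in> f"
        using codeg_ge2D[of u v e] X2[of u v] uv Xe by blast
      have "{u, v} = g" if "g \<in> H" "u \<in> g" "v \<in> g" for g
        using card_subset_eq[of g "{u, v}"] edge[OF that(1)] that True uv(3) by simp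
      then have "{u, v} = e" "{u, v} = f" using e uv f by blast+
      then show False using f(2) by simp
    next
      case False
      then have "card X \<ge> 3" using r edge(2)[OF e] Xe by simp
      then have "e \<in> all_heavy L"
        unfolding all_heavy_def using e Xe all_L[of X] X2 by blast
      then show False using heavy by simp
    qed
  qed
  moreover have "X \<subseteq> e" "Y \<subseteq> e" by (auto simp: X_def Y_def)
  moreover have "X \<union> Y = e" "X \<inter> Y = {}" "X \<noteq> {}" using u0 by (auto simp: X_def Y_def)
  moreover have "card X \<le> t + 1" by (rule size) (use X2 \<open>X \<subseteq> e\<close> in simp_all)
  moreover have "card Y \<le> t + 1" by (rule size) (use Y2 \<open>Y \<subseteq> e\<close> in simp_all)
  moreover have "\<forall>x\<in>X. \<forall>y\<in>Y. codeg x y = 1" by (intro ballI cross)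
  ultimately show ?thesis by blast
qed

text \<open>A pair of codegree 1 belongs to one edge only, so the sets \<open>P e\<close> are
  disjoint, and the Mantel bound for \<open>light 2\<close> limits their union.\<close>

lemma card_balanced_edges:
  assumes C: "C \<subseteq> H" "\<And>e. e \<in> C \<Longrightarrow> e \<notin> unbalanced M \<and> e \<notin> all_heavy L \<and> e \<notin> light_triangle_edges (M * L)"
    and M: "M \<ge> 1" and L: "L \<ge> 2 * t + 1" and t: "t \<ge> 1" and r_le: "r \<le> 2 * t + 2"
    and k: "k = min (r - 1) (t + 1)"
  shows "4 * k * (r - k) * card C \<le> n * (n + D + 2 * r)"
proof -
  define P where "P e = {(x, y) \<in> e \<times> e. light 2 x y}" for e
  have fP: "finite (P e)" if "e \<in> H" for e
    by (rule finite_subset[of _ "e \<times> e"]) (use edge(3)[OF that] in \<open>auto simp: P_def\<close>)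
  have card_P: "2 * (k * (r - k)) \<le> card (P e)" if e: "e \<in> C" for e
  proof -
    have eH: "e \<in> H" using C e by blast
    obtain X Y where XY: "X \<union> Y = e" "X \<inter> Y = {}" "X \<noteq> {}" "Y \<noteq> {}" "card X \<le> t + 1" "card Y \<le> t + 1"
      and one: "\<And>x y. x \<in> X \<Longrightarrow> y \<in> Y \<Longrightarrow> codeg x y = 1"
      using balanced_edge_structure[OF eH _ _ _ M L t] C(2)[OF e] by metis
    have fXY: "finite X" "finite Y" using XY(1) edge(3)[OF eH] by auto
    have sum: "card X + card Y = r" using card_Un_disjoint[OF fXY XY(2)] XY(1) edge(2)[OF eH] by simp
    have pos: "card X > 0" "card Y > 0" using fXY XY by (auto simp: card_gt_0_iff)
    have "k * (r - k) \<le> card X * card Y"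
    proof -
      define a where "a = int (card X)"
      have b: "int (card Y) = int r - a" using sum by (simp add: a_def)
      have kr: "k \<le> r" "int (r - k) = int r - int k" using k by auto
      \<comment> \<open>Neither class has more than \<open>k\<close> vertices, so both factors are
        nonnegative; expanded, this says that the most uneven split minimises the product.\<close>
      have "(int k - a) * (int k - (int r - a)) \<ge> 0"
        using k pos XY(5,6) sum r by (intro mult_nonneg_nonneg) (auto simp: a_def)
      then have "int k * (int r - int k) \<le> a * (int r - a)" by (simp add: algebra_simps)
      then have "int (k * (r - k)) \<le> int (card X * card Y)"
        using b kr by (simp add: a_def)
      then show ?thesis by linarith
    qed
    moreover have "card (X \<times> Y \<union> Y \<times> X) = 2 * (card X * card Y)"
      using fXY XY(2) by (subst card_Un_disjoint) (auto simp: card_cartesian_product)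
    moreover have "X \<times> Y \<union> Y \<times> X \<subseteq> P e"
    proof -
      have "light 2 x y \<and> light 2 y x" if "x \<in> X" "y \<in> Y" for x y
        using one[OF that] codeg_commute[of x y] XY(2) that by (auto simp: light_def)
      then show ?thesis using XY(1) by (auto simp: P_def)
    qed
    then have "card (X \<times> Y \<union> Y \<times> X) \<le> card (P e)" using fP[OF eH] by (rule card_mono[rotated])
    ultimately show ?thesis by linarith
  qed
  have disj: "P e \<inter> P f = {}" if "e \<in> H" "f \<in> H" "e \<noteq> f" for e f
  proof (rule ccontr)
    assume "\<not> ?thesis"
    then obtain x y where xy: "x \<in> e" "y \<in> e" "x \<in> f" "y \<in> f" "codeg x y < 2" by (auto simp: P_def light_def)
    then have "card {e, f} \<le> codeg x y"
      unfolding codeg_def using finite_H that by (intro card_mono) auto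
    then show False using xy that by simp
  qed
  have fC: "finite C" using C finite_H finite_subset by blast
  have "2 * (k * (r - k)) * card C = (\<Sum>e\<in>C. 2 * (k * (r - k)))" by simp
  also have "\<dots> \<le> (\<Sum>e\<in>C. card (P e))" by (intro sum_mono card_P)
  also have "\<dots> = card (\<Union>e\<in>C. P e)"
    using fC fP disj C(1) by (intro card_UN_disjoint[symmetric]) blast+
  also have "\<dots> \<le> card {(x, y) \<in> {..<n} \<times> {..<n}. light 2 x y}"
  proof (rule card_mono)
    show "finite {(x, y) \<in> {..<n} \<times> {..<n}. light 2 x y}"
      by (rule finite_subset[of _ "{..<n} \<times> {..<n}"]) auto
    show "(\<Union>e\<in>C. P e) \<subseteq> {(x, y) \<in> {..<n} \<times> {..<n}. light 2 x y}"
    proof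
      fix p assume "p \<in> (\<Union>e\<in>C. P e)"
      then obtain e where "e \<in> C" "p \<in> P e" by blast
      then show "p \<in> {(x, y) \<in> {..<n} \<times> {..<n}. light 2 x y}"
        using edge(1)[of e] C(1) by (auto simp: P_def)
    qed
  qed
  finally have "2 * (k * (r - k)) * card C \<le> card {(x, y) \<in> {..<n} \<times> {..<n}. light 2 x y}" .
  moreover have "2 * card {(x, y) \<in> {..<n} \<times> {..<n}. light 2 x y} \<le> n * (n + (D + 2 * r))"
    using few_triangles.card_edges_le[OF few_triangles_light[of 2]] by simp
  ultimately show ?thesis by (simp add: algebra_simps)
qed

text \<open>The last summand stays expressed by triangles, so that \<open>M\<close> and
  \<open>L\<close> can be fixed before \<open>n\<close> is taken large enough to make it
  small.\<close>

lemma card_H_upper: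
  assumes "M \<ge> 1" "L \<ge> 2 * t + 1" "t \<ge> 1" "r \<le> 2 * t + 2" "k = min (r - 1) (t + 1)"
  shows "real (card H) \<le> real (n * (n + D + 2 * r)) / (4 * real k * real (r - k))
    + real (D * r\<^sup>2 * (1 + 2 ^ D)) / real M * (real n)\<^sup>2
    + real (2 ^ D * r\<^sup>2 * (1 + 2 ^ D)) / real L * (real n)\<^sup>2
    + real (M * L) * real (card (few_triangles.triangles {..<n} (light (M * L))))"
proof -
  define C where "C = H - unbalanced M - all_heavy L - light_triangle_edges (M * L)"
  have "real (4 * k * (r - k) * card C) \<le> real (n * (n + D + 2 * r))"
    using card_balanced_edges[of C M L k] assms by (intro of_nat_mono) (auto simp: C_def)
  moreover have "k > 0" "r - k > 0" using assms(3,5) r by auto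
  ultimately have 1: "real (card C) \<le> real (n * (n + D + 2 * r)) / (4 * real k * real (r - k))"
    by (subst pos_le_divide_eq) (auto simp: mult_ac)
  have H_le: "real (card H) \<le> real ((1 + 2 ^ D) * n\<^sup>2)" using card_H_le by (rule of_nat_mono)
  have "real M * real (card (unbalanced M)) \<le> real (D * r\<^sup>2) * real (card H)"
    using card_unbalanced[of M] unfolding of_nat_mult[symmetric] of_nat_le_iff .
  also have "\<dots> \<le> real (D * r\<^sup>2) * real ((1 + 2 ^ D) * n\<^sup>2)"
    by (intro mult_left_mono H_le) simp
  finally have 2: "real (card (unbalanced M)) \<le> real (D * r\<^sup>2 * (1 + 2 ^ D)) / real M * (real n)\<^sup>2"
    using assms(1) by (simp add: field_simps)
  have "L * card (all_heavy L) \<le> L * (2 ^ D * card {(u, v) \<in> {..<n} \<times> {..<n}. codeg u v \<ge> L})"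
    using assms by (intro mult_left_mono card_all_heavy) auto
  also have "\<dots> = 2 ^ D * (L * card {(u, v) \<in> {..<n} \<times> {..<n}. codeg u v \<ge> L})" by simp
  also have "\<dots> \<le> 2 ^ D * (r\<^sup>2 * card H)"
    by (intro mult_left_mono card_heavy_pairs) auto
  finally have "real L * real (card (all_heavy L)) \<le> real (2 ^ D * r\<^sup>2) * real (card H)"
    unfolding of_nat_mult[symmetric] of_nat_le_iff by (simp add: mult.assoc)
  also have "\<dots> \<le> real (2 ^ D * r\<^sup>2) * real ((1 + 2 ^ D) * n\<^sup>2)"
    by (intro mult_left_mono H_le) simp
  finally have 3: "real (card (all_heavy L)) \<le> real (2 ^ D * r\<^sup>2 * (1 + 2 ^ D)) / real L * (real n)\<^sup>2"
    using assms(2) by (simp add: field_simps)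
  have 4: "real (card (light_triangle_edges (M * L))) \<le>
      real (M * L) * real (card (few_triangles.triangles {..<n} (light (M * L))))"
    using card_light_triangle_edges[of "M * L"] unfolding of_nat_mult[symmetric] of_nat_le_iff .
  have "H \<subseteq> C \<union> (unbalanced M \<union> (all_heavy L \<union> light_triangle_edges (M * L)))"
    by (auto simp: C_def)
  moreover have "finite (C \<union> (unbalanced M \<union> (all_heavy L \<union> light_triangle_edges (M * L))))"
    using finite_H by (auto simp: C_def unbalanced_def all_heavy_def light_triangle_edges_def)
  ultimately have "card H \<le> card (C \<union> (unbalanced M \<union> (all_heavy L \<union> light_triangle_edges (M * L))))"
    by (rule card_mono[rotated])
  also have "\<dots> \<le> card C + (card (unbalanced M) + (card (all_heavy L) + card (light_triangle_edges (M * L))))"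
    by (meson card_Un_le add_left_mono order_trans)
  finally have "real (card H) \<le> real (card C) + (real (card (unbalanced M)) + (real (card (all_heavy L)) + real (card (light_triangle_edges (M * L)))))"
    unfolding of_nat_add[symmetric] of_nat_le_iff .
  from order_trans[OF this add_mono[OF 1 add_mono[OF 2 add_mono[OF 3 4]]]] show ?thesis
    by (simp only: add.assoc)
qed

end

section \<open>Choice of parameters for the upper bound\<close>

lemma ex_nat_ge_div:
  fixes c \<epsilon> :: real
  assumes "\<epsilon> > 0" "c \<ge> 0"
  obtains m :: nat where "m \<ge> m0" "m \<ge> 1" "c / real m \<le> \<epsilon>"
proof -
  define m where "m = max (max m0 1) (nat \<lceil>c / \<epsilon>\<rceil>)"
  have "c / \<epsilon> \<le> real m" unfolding m_def by linarith
  then have "c / real m \<le> \<epsilon>" using assms unfolding m_def by (simp add: field_simps)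
  then show thesis by (intro that[of m]) (auto simp: m_def)
qed

lemma berge_book_free_upper:
  fixes \<epsilon> :: real
  assumes "t \<ge> 1" "r \<ge> 2" "r \<le> 2 * t + 2" "k = min (r - 1) (t + 1)" and \<epsilon>: "\<epsilon> > 0"
  shows "\<forall>\<^sub>F n in sequentially. \<forall>H. berge_book_free r t n H \<longrightarrow>
    real (card H) \<le> (real n)\<^sup>2 / (4 * real k * real (r - k)) + \<epsilon> * (real n)\<^sup>2"
proof -
  define D where "D = r * (2 * t + 1)"
  obtain M where M: "M \<ge> 1" "real (D * r\<^sup>2 * (1 + 2 ^ D)) / real M \<le> \<epsilon> / 4"
    using ex_nat_ge_div[of "\<epsilon> / 4" "real (D * r\<^sup>2 * (1 + 2 ^ D))" 1] \<epsilon> by (metis divide_pos_pos of_nat_0_le_iff zero_less_numeral)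
  obtain L where L: "L \<ge> 2 * t + 1" "real (2 ^ D * r\<^sup>2 * (1 + 2 ^ D)) / real L \<le> \<epsilon> / 4"
    using ex_nat_ge_div[of "\<epsilon> / 4" "real (2 ^ D * r\<^sup>2 * (1 + 2 ^ D))" "2 * t + 1"] \<epsilon> by (metis divide_pos_pos of_nat_0_le_iff zero_less_numeral)
  define C where "C = M * L"
  have C: "real C > 0" using M L by (simp add: C_def)
  obtain N where N: "\<And>(V :: nat set) E. few_triangles V E (D + C * r) \<Longrightarrow> card V \<ge> N \<Longrightarrow>
      real (card (few_triangles.triangles V E)) \<le> \<epsilon> / (4 * real C) * (real (card V))\<^sup>2"
    using few_triangles_per_edge[of "\<epsilon> / (4 * real C)" "D + C * r"] \<epsilon> C by auto
  define N' where "N' = nat \<lceil>4 * real (D + 2 * r) / \<epsilon>\<rceil>"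
  show ?thesis
  proof (rule eventually_sequentiallyI[of "max N N'"], intro allI impI)
    fix n H assume n: "max N N' \<le> n" and bf: "berge_book_free r t n H"
    interpret B: berge_book_free r t n H by (rule bf)
    have D: "B.D = D" by (simp add: B.D_def D_def)
    have kr: "k > 0" "r - k > 0" using assms by auto
    have "real k * real (r - k) \<ge> 1 * 1" using kr by (intro mult_mono) auto
    then have q: "4 * real k * real (r - k) \<ge> 1" unfolding mult.assoc by linarith
    have "4 * real (D + 2 * r) / \<epsilon> \<le> real n" using n unfolding N'_def by linarith
    then have "real (D + 2 * r) \<le> \<epsilon> / 4 * real n" using \<epsilon> by (simp add: field_simps)
    then have lin: "real n * real (D + 2 * r) \<le> \<epsilon> / 4 * (real n)\<^sup>2"
      using mult_left_mono[of "real (D + 2 * r)" "\<epsilon> / 4 * real n" "real n"] by (simp add: power2_eq_square mult_ac)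
    have eq: "real (n * (n + D + 2 * r)) / (4 * real k * real (r - k))
        = (real n)\<^sup>2 / (4 * real k * real (r - k)) + real n * real (D + 2 * r) / (4 * real k * real (r - k))"
      by (simp add: add_divide_distrib[symmetric] power2_eq_square algebra_simps)
    have le: "real n * real (D + 2 * r) / (4 * real k * real (r - k)) \<le> real n * real (D + 2 * r) / 1"
    proof (rule divide_left_mono[OF q])
      show "0 < 4 * real k * real (r - k) * 1"
        unfolding mult_1_right by (rule less_le_trans[OF zero_less_one q])
    qed simp
    have 1: "real (n * (n + D + 2 * r)) / (4 * real k * real (r - k))
        \<le> (real n)\<^sup>2 / (4 * real k * real (r - k)) + \<epsilon> / 4 * (real n)\<^sup>2"
      unfolding eq using order_trans[OF le[unfolded div_by_1] lin] by (rule add_left_mono)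
    have 2: "real (D * r\<^sup>2 * (1 + 2 ^ D)) / real M * (real n)\<^sup>2 \<le> \<epsilon> / 4 * (real n)\<^sup>2"
      by (intro mult_right_mono M(2)) simp
    have 3: "real (2 ^ D * r\<^sup>2 * (1 + 2 ^ D)) / real L * (real n)\<^sup>2 \<le> \<epsilon> / 4 * (real n)\<^sup>2"
      by (intro mult_right_mono L(2)) simp
    have "real (card (few_triangles.triangles {..<n} (B.light C))) \<le> \<epsilon> / (4 * real C) * (real n)\<^sup>2"
      using N[OF B.few_triangles_light[of C, unfolded D]] n by simp
    then have "real C * real (card (few_triangles.triangles {..<n} (B.light C))) \<le> real C * (\<epsilon> / (4 * real C) * (real n)\<^sup>2)"
      by (intro mult_left_mono) auto
    then have 4: "real C * real (card (few_triangles.triangles {..<n} (B.light C))) \<le> \<epsilon> / 4 * (real n)\<^sup>2"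
      using C by simp
    have quarters: "x + \<epsilon> / 4 * y + \<epsilon> / 4 * y + \<epsilon> / 4 * y + \<epsilon> / 4 * y = x + \<epsilon> * y" for x y :: real
      by simp
    show "real (card H) \<le> (real n)\<^sup>2 / (4 * real k * real (r - k)) + \<epsilon> * (real n)\<^sup>2"
      using order_trans[OF B.card_H_upper[OF M(1) L(1) assms(1,3,4), unfolded D C_def[symmetric]]
          add_mono[OF add_mono[OF add_mono[OF 1 2] 3] 4]]
      unfolding quarters .
  qed
qed

subsection \<open>The extremal construction\<close>

text \<open>Two of \<open>u\<close>, \<open>v\<close>, \<open>w\<close> lie on the same side, which
  makes all three edges agree in that coordinate. If the third vertex were on the other side, two
  edges would agree in both coordinates and coincide.\<close>

lemma grid_edge_determined:
  fixes A B :: "nat \<Rightarrow> 'a set"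
  assumes disjA: "\<And>i i'. i \<noteq> i' \<Longrightarrow> A i \<inter> A i' = {}" and disjB: "\<And>j j'. j \<noteq> j' \<Longrightarrow> B j \<inter> B j' = {}"
    and disjAB: "\<And>i j. A i \<inter> B j = {}"
    and H: "H = (\<lambda>(i, j). A i \<union> B j) ` (I \<times> J)"
    and e: "e1 \<in> H" "e2 \<in> H" "e3 \<in> H" "e1 \<noteq> e2" "e1 \<noteq> e3" "e2 \<noteq> e3"
    and uvw: "u \<in> e1" "v \<in> e1" "u \<in> e2" "w \<in> e2" "v \<in> e3" "w \<in> e3"
  shows "(\<exists>i. {u, v, w} \<subseteq> A i) \<or> (\<exists>j. {u, v, w} \<subseteq> B j)"
proof -
  obtain i1 j1 i2 j2 i3 j3 where ij: "e1 = A i1 \<union> B j1" "e2 = A i2 \<union> B j2" "e3 = A i3 \<union> B j3"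
    using e(1-3) unfolding H by auto
  have eqA: "i = i'" if "x \<in> A i" "x \<in> A i'" for x i i' using disjA[of i i'] that by auto
  have eqB: "j = j'" if "x \<in> B j" "x \<in> B j'" for x j j' using disjB[of j j'] that by auto
  have AB: False if "x \<in> A i" "x \<in> B j" for x i j using disjAB[of i j] that by auto
  have ne: "\<not> (i1 = i2 \<and> j1 = j2)" "\<not> (i1 = i3 \<and> j1 = j3)" "\<not> (i2 = i3 \<and> j2 = j3)"
    using e(4-6) ij by auto
  from uvw have "u \<in> A i1 \<or> u \<in> B j1" "v \<in> A i1 \<or> v \<in> B j1" "u \<in> A i2 \<or> u \<in> B j2"
    "w \<in> A i2 \<or> w \<in> B j2" "v \<in> A i3 \<or> v \<in> B j3" "w \<in> A i3 \<or> w \<in> B j3"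
    by (auto simp: ij)
  then consider "u \<in> A i1" "v \<in> A i1" "u \<in> A i2" "w \<in> A i2" "v \<in> A i3" "w \<in> A i3"
    | "u \<in> B j1" "v \<in> B j1" "u \<in> B j2" "w \<in> B j2" "v \<in> B j3" "w \<in> B j3"
    | "i1 = i2 \<and> j1 = j2 \<or> i1 = i3 \<and> j1 = j3 \<or> i2 = i3 \<and> j2 = j3"
    using eqA eqB AB by metis
  then show ?thesis
  proof cases
    case 1
    then have "{u, v, w} \<subseteq> A i1" using eqA[of u i1 i2] by auto
    then show ?thesis by blast
  next
    case 2
    then have "{u, v, w} \<subseteq> B j1" using eqB[of u j1 j2] by auto
    then show ?thesis by blast
  qed (use ne in blast)
qed

text \<open>All triangles of the book share \<open>\<phi> 0\<close>, so the blocks containing them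
  are one and the same, too small for \<open>t + 2\<close> vertices.\<close>

lemma grid_berge_book_free:
  fixes A B :: "nat \<Rightarrow> nat set"
  assumes disj: "\<And>i i'. i \<noteq> i' \<Longrightarrow> A i \<inter> A i' = {}" "\<And>j j'. j \<noteq> j' \<Longrightarrow> B j \<inter> B j' = {}" "\<And>i j. A i \<inter> B j = {}"
    and size: "\<And>i. finite (A i) \<and> card (A i) \<le> t + 1" "\<And>j. finite (B j) \<and> card (B j) \<le> t + 1"
    and t: "t \<ge> 1"
  shows "\<not> berge_copy (book_vertices t) (book_edges t) n ((\<lambda>(i, j). A i \<union> B j) ` (I \<times> J))" (is "\<not> berge_copy _ _ _ ?H")
proof
  assume "berge_copy (book_vertices t) (book_edges t) n ?H"
  then obtain \<phi> f where \<phi>: "inj_on \<phi> (book_vertices t)" and f: "inj_on f (book_edges t)" "f ` book_edges t \<subseteq> ?H"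
    and "\<forall>e\<in>book_edges t. \<phi> ` e \<subseteq> f e"
    unfolding berge_copy_def by (elim exE conjE) (rule that)
  then have sub: "\<phi> ` e \<subseteq> f e" if "e \<in> book_edges t" for e using that by simp
  have tri: "(\<exists>k. {\<phi> 0, \<phi> 1, \<phi> (i + 1)} \<subseteq> A k) \<or> (\<exists>k. {\<phi> 0, \<phi> 1, \<phi> (i + 1)} \<subseteq> B k)" if i: "i \<in> {1..t}" for i
  proof -
    have edges: "{0, 1} \<in> book_edges t" "{0, i + 1} \<in> book_edges t" "{1, i + 1} \<in> book_edges t"
      using i by (auto simp: book_edges_def)
    have ne: "f {0, 1} \<noteq> f {0, i + 1}" "f {0, 1} \<noteq> f {1, i + 1}" "f {0, i + 1} \<noteq> f {1, i + 1}"
      using edges i by (auto simp: inj_on_eq_iff[OF f(1)] doubleton_eq_iff)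
    have inH: "f {0, 1} \<in> ?H" "f {0, i + 1} \<in> ?H" "f {1, i + 1} \<in> ?H" using f(2) edges by blast+
    show ?thesis
      by (rule grid_edge_determined[OF disj refl inH ne])
        (use sub[OF edges(1)] sub[OF edges(2)] sub[OF edges(3)] in auto)
  qed
  \<comment> \<open>The first page exists because \<open>t \<ge> 1\<close>; it determines the block
    that all others must share.\<close>
  have one: "1 \<in> {1..t}" using t by simp
  have eqA: "i = i'" if "x \<in> A i" "x \<in> A i'" for x i i' using disj(1)[of i i'] that by auto
  have eqB: "j = j'" if "x \<in> B j" "x \<in> B j'" for x j j' using disj(2)[of j j'] that by auto
  have AB: False if "x \<in> A i" "x \<in> B j" for x i j using disj(3)[of i j] that by auto
  have "\<exists>S. finite S \<and> card S \<le> t + 1 \<and> \<phi> ` book_vertices t \<subseteq> S"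
  proof -
    have vert: "i = 0 \<or> i = 1 \<or> (\<exists>j\<in>{1..t}. i = j + 1)" if "i \<in> book_vertices t" for i
      using that by (cases i) (auto simp: book_vertices_def)
    from tri[OF one] show ?thesis
    proof (elim disjE exE)
      fix k assume k: "{\<phi> 0, \<phi> 1, \<phi> (1 + 1)} \<subseteq> A k"
      have mem: "\<phi> (i + 1) \<in> A k" if "i \<in> {1..t}" for i
        using tri[OF that]
      proof (elim disjE exE)
        fix k' assume k': "{\<phi> 0, \<phi> 1, \<phi> (i + 1)} \<subseteq> A k'"
        then have "k' = k" using eqA[of "\<phi> 0" k' k] k by simp
        then show ?thesis using k' by simp
      next
        fix k' assume "{\<phi> 0, \<phi> 1, \<phi> (i + 1)} \<subseteq> B k'"
        then show ?thesis using AB[of "\<phi> 0" k k'] k by simp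
      qed
      have "\<phi> i \<in> A k" if "i \<in> book_vertices t" for i
        using vert[OF that] k mem by auto
      then have "\<phi> ` book_vertices t \<subseteq> A k" by auto
      then show ?thesis using size(1) by blast
    next
      fix k assume k: "{\<phi> 0, \<phi> 1, \<phi> (1 + 1)} \<subseteq> B k"
      have mem: "\<phi> (i + 1) \<in> B k" if "i \<in> {1..t}" for i
        using tri[OF that]
      proof (elim disjE exE)
        fix k' assume k': "{\<phi> 0, \<phi> 1, \<phi> (i + 1)} \<subseteq> B k'"
        then have "k' = k" using eqB[of "\<phi> 0" k' k] k by simp
        then show ?thesis using k' by simp
      next
        fix k' assume "{\<phi> 0, \<phi> 1, \<phi> (i + 1)} \<subseteq> A k'"
        then show ?thesis using AB[of "\<phi> 0" k' k] k by simp
      qed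
      have "\<phi> i \<in> B k" if "i \<in> book_vertices t" for i
        using vert[OF that] k mem by auto
      then have "\<phi> ` book_vertices t \<subseteq> B k" by auto
      then show ?thesis using size(2) by blast
    qed
  qed
  then obtain S where S: "finite S" "card S \<le> t + 1" "\<phi> ` book_vertices t \<subseteq> S" by blast
  then have "card (book_vertices t) \<le> t + 1" using card_inj_on_le[OF \<phi> S(3,1)] by simp
  then show False by (simp add: book_vertices_def)
qed

section \<open>The extremal number and its asymptotics\<close>

lemma finite_uniform_hypergraphs: "finite (uniform_hypergraphs r n)"
  by (simp add: uniform_hypergraphs_def)

lemma card_le_ex_berge:
  assumes "H \<in> uniform_hypergraphs r n" "\<not> berge_copy VF EF n H"
  shows "card H \<le> ex_berge r n VF EF"
  unfolding ex_berge_def using assms finite_uniform_hypergraphs[of r n] by (intro Max_ge) auto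

text \<open>As \<open>EF\<close> is nonempty, the empty hypergraph is admissible and the maximum is
  over a nonempty set.\<close>

lemma ex_berge_attained:
  assumes "EF \<noteq> {}"
  shows "\<exists>H \<in> uniform_hypergraphs r n. \<not> berge_copy VF EF n H \<and> card H = ex_berge r n VF EF"
proof -
  have "{} \<in> uniform_hypergraphs r n" "\<not> berge_copy VF EF n {}"
    using assms by (auto simp: uniform_hypergraphs_def berge_copy_def)
  then have "ex_berge r n VF EF \<in> card ` {H \<in> uniform_hypergraphs r n. \<not> berge_copy VF EF n H}"
    unfolding ex_berge_def using finite_uniform_hypergraphs[of r n] by (intro Max_in) auto
  then show ?thesis by auto
qed

lemma ex_berge_book_ge:
  assumes t: "t \<ge> 1" and ab: "1 \<le> a" "a \<le> t + 1" "1 \<le> b" "b \<le> t + 1"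
  shows "(n div (2 * a)) * (n div (2 * b)) \<le> ex_berge (a + b) n (book_vertices t) (book_edges t)"
proof -
  define p q where "p = n div (2 * a)" and "q = n div (2 * b)"
  \<comment> \<open>Blocks out of range are empty, so disjointness and size bounds hold for all
    indices. The right blocks start at \<open>a * p\<close>, and each side uses at most half of the
    vertices.\<close>
  define A where "A i = (if i < p then {a * i..<a * i + a} else {})" for i
  define B where "B j = (if j < q then {a * p + b * j..<a * p + b * j + b} else {})" for j
  define H where "H = (\<lambda>(i, j). A i \<union> B j) ` ({..<p} \<times> {..<q})"
  have block_le: "c * i + c \<le> c * m" if "i < m" for c i m :: nat
    using mult_le_mono2[of "Suc i" m c] that by simp
  have disjA: "A i \<inter> A i' = {}" if "i \<noteq> i'" for i i'
  proof -
    have "a * i + a \<le> a * i' \<or> a * i' + a \<le> a * i"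
      using block_le[of i i' a] block_le[of i' i a] that by linarith
    then show ?thesis by (auto simp: A_def)
  qed
  have disjB: "B j \<inter> B j' = {}" if "j \<noteq> j'" for j j'
  proof -
    have "b * j + b \<le> b * j' \<or> b * j' + b \<le> b * j"
      using block_le[of j j' b] block_le[of j' j b] that by linarith
    then show ?thesis by (auto simp: B_def)
  qed
  have A_lt: "x < a * p" if "x \<in> A i" for x i
    using that block_le[of i p a] by (auto simp: A_def split: if_splits)
  have B_ge: "x \<ge> a * p" if "x \<in> B j" for x j
    using that by (auto simp: B_def split: if_splits)
  have disjAB: "A i \<inter> B j = {}" for i j using A_lt B_ge by fastforce
  have "2 * (a * p) \<le> n" "2 * (b * q) \<le> n"
    using div_times_less_eq_dividend[of n "2 * a"] div_times_less_eq_dividend[of n "2 * b"]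
    by (simp_all add: p_def q_def mult_ac)
  then have pq: "a * p + b * q \<le> n" "a * p \<le> n" by linarith+
  have An: "A i \<subseteq> {..<n}" for i using A_lt pq(2) by fastforce
  have Bn: "B j \<subseteq> {..<n}" for j
  proof
    fix x assume "x \<in> B j"
    then show "x \<in> {..<n}" using block_le[of j q b] pq(1) by (auto simp: B_def split: if_splits)
  qed
  have "H \<in> uniform_hypergraphs (a + b) n"
  proof -
    have "A i \<union> B j \<subseteq> {..<n} \<and> card (A i \<union> B j) = a + b" if "i < p" "j < q" for i j
    proof -
      have "card (A i \<union> B j) = card (A i) + card (B j)"
        using disjAB by (intro card_Un_disjoint) (auto simp: A_def B_def)
      also have "\<dots> = a + b" using that by (simp add: A_def B_def)
      finally show ?thesis using An[of i] Bn[of j] by simp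
    qed
    then show ?thesis by (auto simp: H_def uniform_hypergraphs_def)
  qed
  moreover have "\<not> berge_copy (book_vertices t) (book_edges t) n H"
    unfolding H_def using ab t
    by (intro grid_berge_book_free disjA disjB disjAB) (auto simp: A_def B_def)
  ultimately have "card H \<le> ex_berge (a + b) n (book_vertices t) (book_edges t)"
    by (rule card_le_ex_berge)
  moreover have "card H = p * q"
  proof -
    have "inj_on (\<lambda>(i, j). A i \<union> B j) ({..<p} \<times> {..<q})"
    proof (rule inj_onI, clarify)
      fix i j i' j' assume ij: "i < p" "j < q" "i' < p" "j' < q" and eq: "A i \<union> B j = A i' \<union> B j'"
      have "a * i \<in> A i" "a * p + b * j \<in> B j" using ij ab by (auto simp: A_def B_def)
      then have "a * i \<in> A i'" "a * p + b * j \<in> B j'"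
        using eq disjAB[of i j'] disjAB[of i' j] by blast+
      then show "i = i' \<and> j = j'"
        using disjA[of i i'] disjB[of j j'] \<open>a * i \<in> A i\<close> \<open>a * p + b * j \<in> B j\<close> by blast
    qed
    then show ?thesis by (simp add: H_def card_image card_cartesian_product)
  qed
  ultimately show ?thesis by (simp add: p_def q_def)
qed

lemma real_div_ge: "real (n div m) \<ge> real n / real m - 1"
  using real_of_int_div3[of "int n" "int m"] by (simp add: zdiv_int[symmetric])

theorem theorem4:
  fixes t r :: nat
  assumes "t \<ge> 1" and "r \<ge> 2" and "r \<le> 2 * t + 2"
  defines "k \<equiv> min (r - 1) (t + 1)"
  shows "(\<lambda>n. real (ex_berge r n (book_vertices t) (book_edges t))
            - (real n)^2 / (4 * real k * real (r - k))) \<in> o(\<lambda>n. (real n)^2)"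
proof (rule landau_o.smallI)
  fix \<epsilon> :: real assume \<epsilon>: "\<epsilon> > 0"
  define b where "b = r - k"
  \<comment> \<open>Here \<open>r \<le> 2 * t + 2\<close> enters the lower bound: it gives
    \<open>r - k \<le> t + 1\<close>, so both block sizes are allowed.\<close>
  have ab: "1 \<le> k" "k \<le> t + 1" "1 \<le> b" "b \<le> t + 1" "k + b = r"
    using assms by (auto simp: b_def)
  have upper: "\<forall>\<^sub>F n in sequentially. \<forall>H. berge_book_free r t n H \<longrightarrow>
      real (card H) \<le> (real n)\<^sup>2 / (4 * real k * real (r - k)) + \<epsilon> * (real n)\<^sup>2"
    using assms \<epsilon> by (intro berge_book_free_upper) auto
  have lower: "\<forall>\<^sub>F n in sequentially. 1 / \<epsilon> \<le> real n"
    using eventually_ge_at_top[of "nat \<lceil>1 / \<epsilon>\<rceil>"] by eventually_elim linarith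
  from upper lower
  show "\<forall>\<^sub>F n in sequentially. norm (real (ex_berge r n (book_vertices t) (book_edges t))
      - (real n)\<^sup>2 / (4 * real k * real (r - k))) \<le> \<epsilon> * norm ((real n)\<^sup>2)"
  proof eventually_elim
    case (elim n)
    define x where "x = real (ex_berge r n (book_vertices t) (book_edges t))"
    define q where "q = (real n)\<^sup>2 / (4 * real k * real b)"
    have "book_edges t \<noteq> {}" by (simp add: book_edges_def)
    then obtain H where H: "H \<in> uniform_hypergraphs r n" "\<not> berge_copy (book_vertices t) (book_edges t) n H"
      "card H = ex_berge r n (book_vertices t) (book_edges t)"
      using ex_berge_attained by metis
    then have "berge_book_free r t n H" using assms(2) by unfold_locales
    then have up: "x \<le> q + \<epsilon> * (real n)\<^sup>2" using elim(1) H(3) by (auto simp: x_def q_def b_def)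
    define \<alpha> \<beta> where "\<alpha> = real n / real (2 * k)" and "\<beta> = real n / real (2 * b)"
    have bounds: "0 \<le> \<alpha>" "\<alpha> \<le> real n / 2" "0 \<le> \<beta>" "\<beta> \<le> real n / 2"
      using ab mult_left_mono[of 1 "real k" "real n"] mult_left_mono[of 1 "real b" "real n"]
      by (auto simp: \<alpha>_def \<beta>_def divide_le_eq)
    \<comment> \<open>The inequalities for the floors are not simply multiplied, since
      \<open>\<alpha> - 1\<close> and \<open>\<beta> - 1\<close> can be negative; the two roundings
      are accounted for one after the other.\<close>
    have "\<alpha> * \<beta> - \<alpha> - \<beta> \<le> real (n div (2 * k)) * real (n div (2 * b))"
    proof -
      have ge: "\<alpha> - 1 \<le> real (n div (2 * k))" "\<beta> - 1 \<le> real (n div (2 * b))"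
        unfolding \<alpha>_def \<beta>_def by (rule real_div_ge)+
      have le: "real (n div (2 * k)) \<le> \<alpha>" "real (n div (2 * b)) \<le> \<beta>"
        unfolding \<alpha>_def \<beta>_def by (rule of_nat_div_le_of_nat)+
      have "\<alpha> * (\<beta> - 1) \<le> \<alpha> * real (n div (2 * b))"
        using bounds ge by (intro mult_left_mono)
      moreover have "(\<alpha> - real (n div (2 * k))) * real (n div (2 * b)) \<le> 1 * \<beta>"
        using ge le by (intro mult_mono) auto
      ultimately have "\<alpha> * (\<beta> - 1) + (\<alpha> - real (n div (2 * k))) * real (n div (2 * b))
          \<le> \<alpha> * real (n div (2 * b)) + \<beta>" by simp
      then show ?thesis by (simp add: algebra_simps)
    qed
    also have "\<dots> \<le> x"
      using ex_berge_book_ge[OF assms(1) ab(1-4), of n] ab(5)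
      unfolding x_def of_nat_mult[symmetric] of_nat_le_iff by simp
    finally have "\<alpha> * \<beta> - \<alpha> - \<beta> \<le> x" .
    moreover have "\<alpha> * \<beta> = q" by (simp add: \<alpha>_def \<beta>_def q_def power2_eq_square)
    \<comment> \<open>The rounding loss \<open>\<alpha> + \<beta>\<close> is at most
      \<open>n\<close>, which is at most \<open>\<epsilon> * n^2\<close> once
      \<open>n \<ge> 1 / \<epsilon>\<close>.\<close>
    ultimately have "q - real n \<le> x" using bounds by linarith
    moreover have "real n \<le> \<epsilon> * (real n)\<^sup>2"
      using mult_right_mono[OF elim(2), of "\<epsilon> * real n"] \<epsilon> by (simp add: power2_eq_square mult_ac)
    ultimately have "q - \<epsilon> * (real n)\<^sup>2 \<le> x" by linarith
    with up show ?case unfolding x_def[symmetric] q_def[symmetric, unfolded b_def] by (simp add: abs_le_iff b_def[symmetric])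
  qed
qed

end
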